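(* Let $A_1,\ldots,A_m \in \mathbb{R}^{n \times n}$ be symmetric matrices with $\sum_{i=1}^{m} |A_i| \preceq I_n$, and let $\varepsilon \in (0,1)$ be such that $m = \frac{n}{\varepsilon^2} \ge 100$. Then the set \[ K := \Big\{ x \in \mathbb{R}^m \;:\; \Big\| \sum_{i=1}^m x_i A_i \Big\|_{\mathrm{op}} \leq \varepsilon \Big\} \] has mean width $w(K) \geq \Omega(\sqrt{m})$, i.e. $w(K)\ge c\sqrt m$ for a universal constant $c>0$.
   Context: For a symmetric matrix $A=\sum_i \lambda_i v_iv_i^\top$ (eigendecomposition), $|A| := \sum_i |\lambda_i| v_iv_i^\top$. $\|\cdot\|_{\mathrm{op}}$ is the largest singular value; $A\preceq B$ means $B-A$ is positive semidefinite. The mean width of a set $K\subseteq\mathbb{R}^m$ is $w(K) := \mathbb{E}_{a}\big[\max_{x \in K} \langle a,x\rangle- \min_{x \in K} \langle a,x\rangle\big]$, where $a$ is uniformly distributed on the unit sphere $S^{m-1}$. *)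

theory Defs
  imports "HOL-Analysis.Lebesgue_Measure" "Jordan_Normal_Form.Char_Poly"
begin

text \<open>
  The dimensions \<open>n\<close> and \<open>m\<close> have to be quantified inside the scope of the universal constant,
  so matrices and vectors are those of Jordan_Normal_Form, with their dimensions as explicit
  natural numbers. Families of matrices are indexed from \<open>0\<close>.
\<close>

definition msum :: "nat \<Rightarrow> nat \<Rightarrow> (nat \<Rightarrow> real mat) \<Rightarrow> real mat" where
  "msum n m A = mat n n (\<lambda>ij. \<Sum>k<m. A k $$ ij)"

definition outer :: "real vec \<Rightarrow> real mat" where
  "outer v = mat (dim_vec v) (dim_vec v) (\<lambda>(i, j). v $ i * v $ j)"

definition eigendecomposition :: "real mat \<Rightarrow> (nat \<Rightarrow> real) \<Rightarrow> (nat \<Rightarrow> real vec) \<Rightarrow> bool" where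
  "eigendecomposition A l v \<longleftrightarrow>
     (\<forall>i < dim_row A. v i \<in> carrier_vec (dim_row A)) \<and>
     (\<forall>i < dim_row A. \<forall>j < dim_row A. v i \<bullet> v j = (if i = j then 1 else 0)) \<and>
     A = msum (dim_row A) (dim_row A) (\<lambda>i. l i \<cdot>\<^sub>m outer (v i))"

text \<open>
  For symmetric \<open>A\<close> an eigendecomposition exists, and the matrix below does not depend on the choice
  of one.
\<close>

definition mat_abs :: "real mat \<Rightarrow> real mat" where
  "mat_abs A = (THE B. \<exists>l v. eigendecomposition A l v \<and>
     B = msum (dim_row A) (dim_row A) (\<lambda>i. \<bar>l i\<bar> \<cdot>\<^sub>m outer (v i)))"

definition singular_values :: "real mat \<Rightarrow> real set" where
  "singular_values A = {sqrt k | k. eigenvalue (transpose_mat A * A) k}"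

definition op_norm :: "real mat \<Rightarrow> real" where
  "op_norm A = Max (singular_values A)"

definition pos_semidef :: "real mat \<Rightarrow> bool" where
  "pos_semidef A \<longleftrightarrow> transpose_mat A = A \<and> (\<forall>v \<in> carrier_vec (dim_row A). 0 \<le> v \<bullet> (A *\<^sub>v v))"

definition loewner_le :: "real mat \<Rightarrow> real mat \<Rightarrow> bool" (infix "\<preceq>\<^sub>L" 50) where
  "A \<preceq>\<^sub>L B \<longleftrightarrow> pos_semidef (B - A)"

text \<open>
  The uniform probability distribution on the unit sphere of \<open>\<real>\<^sup>m\<close>, i.e. normalized surface measure:
  a set of directions is weighted by the proportion of the volume of the unit ball that
  lies in the cone over it. Points are extensional functions on \<open>{..<m}\<close>. The centre of the ball,
  which has no direction, is a null set (for \<open>m > 0\<close>).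
\<close>

definition eucl_norm :: "nat \<Rightarrow> (nat \<Rightarrow> real) \<Rightarrow> real" where
  "eucl_norm m a = sqrt (\<Sum>i<m. (a i)\<^sup>2)"

definition uniform_sphere :: "nat \<Rightarrow> (nat \<Rightarrow> real) measure" where
  "uniform_sphere m =
     distr (uniform_measure (Pi\<^sub>M {..<m} (\<lambda>_. lborel)) {a \<in> {..<m} \<rightarrow>\<^sub>E UNIV. eucl_norm m a \<le> 1})
       (Pi\<^sub>M {..<m} (\<lambda>_. borel)) (\<lambda>a. \<lambda>i\<in>{..<m}. a i / eucl_norm m a)"

text \<open>
  The mean width may be infinite, since \<open>K\<close> may be unbounded (e.g. if the matrices defining it are
  linearly dependent). The extrema are therefore taken in \<open>ereal\<close>; for nonempty \<open>K\<close> their difference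
  is never negative, so \<open>e2ennreal\<close> loses nothing.
\<close>

definition mean_width :: "nat \<Rightarrow> real vec set \<Rightarrow> ennreal" where
  "mean_width m K =
     (\<integral>\<^sup>+ a. e2ennreal ((SUP x\<in>K. ereal (vec m a \<bullet> x)) - (INF x\<in>K. ereal (vec m a \<bullet> x)))
        \<partial>uniform_sphere m)"

end

theory Submission
  imports Defs
begin

text \<open>
  Reflection symmetry of the sphere reduces the claim to random signs: it suffices to find, for every
  sign vector \<open>s\<close>, a point \<open>x(s)\<close> of \<open>K\<close> with \<open>s\<^sub>i x(s)\<^sub>i \<ge> 0\<close> such that the average of
  \<open>\<Sum>\<^sub>i s\<^sub>i x(s)\<^sub>i\<close> is of order \<open>m\<close>, because a coordinate of a random unit vector has mean absolute value of
  order \<open>1 / sqrt m\<close>.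

  The points are built by revealing the signs one at a time in an adaptive order, always adding
  \<open>s\<^sub>i c A\<^sub>i\<close> to the current matrix \<open>X\<close> for a small constant \<open>c\<close>. As in the sparsification argument of Batson,
  Spielman and Srivastava, the potential \<open>tr (u - X)\<inverse> + tr (u + X)\<inverse>\<close> keeps the spectrum of \<open>X\<close>
  inside \<open>[-u, u]\<close>, where the barrier \<open>u\<close> grows from \<open>\<epsilon> / 2\<close> to at most \<open>\<epsilon>\<close>. Since \<open>\<Sum>\<^sub>i |A\<^sub>i| \<preceq> I\<close>,
  averaging over the unused indices yields an index whose expected second-order effect on the potential
  is compensated by the growth of \<open>u\<close>. Thus the potential is a supermartingale, and with constant
  probability half of the indices can be used.
\<close>


unbundle no vec_syntax
unbundle no inner_syntax


section \<open>Spectral theorem and absolute value\<close>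

text \<open>The relation \<open>m = n / \<epsilon>^2\<close> is what allows steps of constant size.
  With both barriers at \<open>\<epsilon> / 2\<close>, each trace starts at
  \<open>2 n / \<epsilon> = 2 \<epsilon> m\<close>. If \<open>M\<close> is the inverse of a barrier
  matrix, then for a typical index \<open>tr (|A_i| M)\<close> is O(\<epsilon>) and
  \<open>tr (|A_i| M^2)\<close> is O(\<open>tr (M^2) / m\<close>). A constant step therefore costs
  O(\<open>\<epsilon> tr (M^2) / m\<close>) in second order, while raising the barrier by \<delta>
  gains about \<open>\<delta> tr (M^2)\<close>. So shifts of order \<open>\<epsilon> / m\<close>
  suffice, and \<open>m\<close> of them add up to O(\<epsilon>). The first-order effect of a step is
  not controlled at all; it only cancels between the two signs. Hence the index has to be fixed
  before its sign is seen, and the walk is controlled on average over sign patterns, not for each of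
  them. Stopping early on bad patterns is harmless, because untouched coordinates stay 0 and 0
  agrees with either sign.\<close>

lemma bilinear_form_eq_sum:
  assumes "A \<in> carrier_mat n n" "x \<in> carrier_vec n" "y \<in> carrier_vec n"
  shows "x \<bullet> (A *\<^sub>v y) = (\<Sum>i<n. \<Sum>j<n. x $ i * A $$ (i, j) * y $ j)"
  using assms
  by (auto simp: scalar_prod_def sum_distrib_left mult.assoc lessThan_atLeast0 intro!: sum.cong)

lemma symmetric_scalar_prod:
  fixes A :: "real mat"
  assumes "A \<in> carrier_mat n n" "transpose_mat A = A" "x \<in> carrier_vec n" "y \<in> carrier_vec n"
  shows "x \<bullet> (A *\<^sub>v y) = y \<bullet> (A *\<^sub>v x)"
proof -
  have "A $$ (i, j) = A $$ (j, i)" if "i < n" "j < n" for i j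
    using assms(1,2) that by (metis carrier_matD index_transpose_mat(1))
  then show ?thesis
    unfolding bilinear_form_eq_sum[OF assms(1,3,4)] bilinear_form_eq_sum[OF assms(1,4,3)]
    by (subst sum.swap) (auto intro!: sum.cong simp: mult_ac)
qed

lemma scalar_prod_self_ge_0: "0 \<le> (x :: real vec) \<bullet> x"
  by (simp add: scalar_prod_def sum_nonneg)

lemma scalar_prod_self_eq_0_iff:
  fixes x :: "real vec"
  assumes "x \<in> carrier_vec n"
  shows "x \<bullet> x = 0 \<longleftrightarrow> x = 0\<^sub>v n"
proof
  assume "x \<bullet> x = 0"
  then have "\<forall>i\<in>{0..<dim_vec x}. x $ i * x $ i = 0"
    unfolding scalar_prod_def by (subst (asm) sum_nonneg_eq_0_iff) auto
  then show "x = 0\<^sub>v n"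
    using assms by (intro eq_vecI) auto
qed (use assms in auto)

text \<open>The square matrix with rows \<open>v 0\<close>, ..., \<open>v (k - 1)\<close> padded by
  zero rows is singular: row \<open>k\<close> vanishes because \<open>k < n\<close>, so the
  transpose annihilates \<open>unit_vec n k\<close>. A normalized kernel vector is the
  witness.\<close>

lemma exists_unit_vec_orthogonal:
  fixes v :: "nat \<Rightarrow> real vec"
  assumes "k < n" and v: "\<And>j. j < k \<Longrightarrow> v j \<in> carrier_vec n"
  shows "\<exists>x \<in> carrier_vec n. x \<bullet> x = 1 \<and> (\<forall>j<k. v j \<bullet> x = 0)"
proof -
  define R where "R = mat n n (\<lambda>(i, j). if i < k then v i $ j else 0)"
  have R: "R \<in> carrier_mat n n"
    by (simp add: R_def)
  have "transpose_mat R *\<^sub>v unit_vec n k = 0\<^sub>v n"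
    using \<open>k < n\<close> by (intro eq_vecI) (auto simp: R_def)
  then have "det (transpose_mat R) = 0"
    using \<open>k < n\<close> R det_0_iff_vec_prod_zero_field[of "transpose_mat R" n]
    by (metis transpose_carrier_mat unit_vec_carrier unit_vec_nonzero)
  then have "det R = 0"
    using det_transpose[OF R] by simp
  then obtain y where y: "y \<in> carrier_vec n" "y \<noteq> 0\<^sub>v n" "R *\<^sub>v y = 0\<^sub>v n"
    using det_0_iff_vec_prod_zero_field[OF R] by auto
  have pos: "y \<bullet> y > 0"
    using y scalar_prod_self_eq_0_iff[OF y(1)] scalar_prod_self_ge_0[of y] by linarith
  have orth: "v j \<bullet> y = 0" if "j < k" for j
  proof -
    have "row R j = v j"
      using that \<open>k < n\<close> v[OF that] by (intro eq_vecI) (auto simp: R_def)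
    moreover have "(R *\<^sub>v y) $ j = row R j \<bullet> y"
      using that \<open>k < n\<close> R by simp
    ultimately show ?thesis
      using y that \<open>k < n\<close> by simp
  qed
  let ?x = "(1 / sqrt (y \<bullet> y)) \<cdot>\<^sub>v y"
  have "?x \<bullet> ?x = 1"
    using y(1) pos by (simp add: real_div_sqrt field_simps power2_eq_square[symmetric])
  moreover have "\<forall>j<k. v j \<bullet> ?x = 0"
    using y(1) v orth by simp
  ultimately show ?thesis
    using y(1) by (intro bexI[of _ ?x]) auto
qed

text \<open>The maximum is attained by compactness, argued for functions
  \<open>nat \<Rightarrow> real\<close> in the product topology, to which the vectors are
  transported.\<close>

lemma exists_max_quadratic_form_orthogonal:
  fixes A :: "real mat" and v :: "nat \<Rightarrow> real vec"
  assumes A: "A \<in> carrier_mat n n" and "k < n" and v: "\<And>j. j < k \<Longrightarrow> v j \<in> carrier_vec n"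
  shows "\<exists>x \<in> carrier_vec n. x \<bullet> x = 1 \<and> (\<forall>j<k. v j \<bullet> x = 0) \<and>
    (\<forall>y \<in> carrier_vec n. y \<bullet> y = 1 \<longrightarrow> (\<forall>j<k. v j \<bullet> y = 0) \<longrightarrow> y \<bullet> (A *\<^sub>v y) \<le> x \<bullet> (A *\<^sub>v x))"
proof -
  \<comment> \<open>Pinning the coordinates from \<open>n\<close> on to 0 makes every factor
    compact, so Tychonoff applies over the whole index type.\<close>
  define B :: "(nat \<Rightarrow> real) set" where "B = (\<Pi>\<^sub>E i\<in>UNIV. if i < n then {-1..1} else {0})"
  define C where "C = B \<inter> {f. (\<Sum>i<n. f i * f i) = 1} \<inter> (\<Inter>j\<in>{..<k}. {f. (\<Sum>i<n. v j $ i * f i) = 0})"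
  define q where "q f = (\<Sum>i<n. \<Sum>j<n. f i * A $$ (i, j) * f j)" for f
  have "compactin (product_topology (\<lambda>i. euclidean) UNIV) B"
    unfolding B_def compactin_PiE by (auto simp: compactin_euclidean_iff)
  then have "compact B"
    by (simp add: euclidean_product_topology)
  then have "compact C"
    unfolding C_def
    by (intro compact_Int_closed closed_INT closed_Collect_eq ballI)
      (auto intro!: continuous_intros)
  have emb: "(\<lambda>i. if i < n then y $ i else 0) \<in> C"
    if y: "y \<in> carrier_vec n" "y \<bullet> y = 1" "\<forall>j<k. v j \<bullet> y = 0" for y
  proof -
    have "y $ i \<in> {-1..1}" if "i < n" for i
    proof -
      have "y $ i * y $ i \<le> (\<Sum>i<n. y $ i * y $ i)"
        using that by (intro member_le_sum) auto
      also have "\<dots> = 1"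
        using y by (simp add: scalar_prod_def lessThan_atLeast0)
      finally show ?thesis
        using abs_le_square_iff[of "y $ i" 1] by (auto simp: power2_eq_square)
    qed
    then show ?thesis
      using y v by (auto simp: C_def B_def scalar_prod_def lessThan_atLeast0)
  qed
  have unemb: "vec n f \<bullet> vec n f = 1 \<and> (\<forall>j<k. v j \<bullet> vec n f = 0)" if "f \<in> C" for f
    using that by (auto simp: C_def scalar_prod_def lessThan_atLeast0)
  have "C \<noteq> {}"
    using exists_unit_vec_orthogonal[of k n v] \<open>k < n\<close> v emb by blast
  moreover have "continuous_on C q"
    unfolding q_def
    by (auto intro!: continuous_intros continuous_on_subset[OF continuous_on_product_coordinates])
  ultimately obtain f where f: "f \<in> C" "\<forall>g\<in>C. q g \<le> q f"
    using continuous_attains_sup[OF \<open>compact C\<close>] by blast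
  have "y \<bullet> (A *\<^sub>v y) \<le> vec n f \<bullet> (A *\<^sub>v vec n f)"
    if y: "y \<in> carrier_vec n" "y \<bullet> y = 1" "\<forall>j<k. v j \<bullet> y = 0" for y
    using f(2) emb[OF y] by (force simp: bilinear_form_eq_sum[OF A] q_def y)
  then show ?thesis
    using unemb[OF f(1)] by (intro bexI[of _ "vec n f"]) auto
qed

text \<open>First-order optimality in the direction \<open>A x - \<mu> x\<close>, which is itself admissible.\<close>

lemma exists_eigenvector_orthogonal:
  fixes A :: "real mat" and v :: "nat \<Rightarrow> real vec"
  assumes A: "A \<in> carrier_mat n n" "transpose_mat A = A" and "k < n"
    and v: "\<And>j. j < k \<Longrightarrow> v j \<in> carrier_vec n"
    and ev: "\<And>j. j < k \<Longrightarrow> A *\<^sub>v v j = l j \<cdot>\<^sub>v v j"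
  shows "\<exists>x \<mu>. x \<in> carrier_vec n \<and> x \<bullet> x = 1 \<and> (\<forall>j<k. v j \<bullet> x = 0) \<and> A *\<^sub>v x = \<mu> \<cdot>\<^sub>v x"
proof -
  obtain x where x: "x \<in> carrier_vec n" "x \<bullet> x = 1" and orth: "\<forall>j<k. v j \<bullet> x = 0"
    and max: "\<And>y. y \<in> carrier_vec n \<Longrightarrow> y \<bullet> y = 1 \<Longrightarrow> \<forall>j<k. v j \<bullet> y = 0 \<Longrightarrow>
      y \<bullet> (A *\<^sub>v y) \<le> x \<bullet> (A *\<^sub>v x)"
    using exists_max_quadratic_form_orthogonal[of A n k v] A \<open>k < n\<close> v by blast
  define \<mu> where "\<mu> = x \<bullet> (A *\<^sub>v x)"
  have Ax[simp]: "A *\<^sub>v y \<in> carrier_vec n" if "y \<in> carrier_vec n" for y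
    using A that by auto
  \<comment> \<open>The homogeneous form of maximality admits trial vectors that are not normalized,
    such as \<open>x + t r\<close> below.\<close>
  have hom: "y \<bullet> (A *\<^sub>v y) \<le> \<mu> * (y \<bullet> y)" if y: "y \<in> carrier_vec n" "\<forall>j<k. v j \<bullet> y = 0" for y
  proof (cases "y = 0\<^sub>v n")
    case True
    then show ?thesis using A by (simp add: mult_mat_vec_def)
  next
    case False
    then have pos: "y \<bullet> y > 0"
      using y scalar_prod_self_eq_0_iff[OF y(1)] scalar_prod_self_ge_0[of y] by linarith
    define c where "c = 1 / sqrt (y \<bullet> y)"
    have cc: "c * c = 1 / (y \<bullet> y)"
      using pos by (simp add: c_def)
    have "(c \<cdot>\<^sub>v y) \<bullet> (A *\<^sub>v (c \<cdot>\<^sub>v y)) \<le> \<mu>"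
      unfolding \<mu>_def using y v cc pos by (intro max) (auto simp: mult.assoc[symmetric])
    also have "(c \<cdot>\<^sub>v y) \<bullet> (A *\<^sub>v (c \<cdot>\<^sub>v y)) = (c * c) * (y \<bullet> (A *\<^sub>v y))"
      using y A by (simp add: mult_mat_vec[of _ n n])
    finally show ?thesis
      using pos by (simp add: cc field_simps)
  qed
  define r where "r = A *\<^sub>v x - \<mu> \<cdot>\<^sub>v x"
  have r: "r \<in> carrier_vec n"
    using x by (simp add: r_def)
  have xr: "x \<bullet> r = 0"
    using x unfolding r_def by (subst scalar_prod_minus_distrib[of _ n]) (auto simp: \<mu>_def)
  have vr: "v j \<bullet> r = 0" if "j < k" for j
  proof -
    have "v j \<bullet> (A *\<^sub>v x) = x \<bullet> (A *\<^sub>v v j)"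
      using A x v[OF that] by (intro symmetric_scalar_prod) auto
    also have "\<dots> = l j * (v j \<bullet> x)"
      using ev[OF that] x v[OF that] comm_scalar_prod[of x n "v j"] by simp
    finally show ?thesis
      using x v[OF that] orth that unfolding r_def by (subst scalar_prod_minus_distrib[of _ n]) auto
  qed
  have rAx: "r \<bullet> (A *\<^sub>v x) = r \<bullet> r"
  proof -
    have "r \<bullet> r = r \<bullet> (A *\<^sub>v x) - \<mu> * (r \<bullet> x)"
      using x r by (subst (2) r_def, subst scalar_prod_minus_distrib[of _ n]) auto
    then show ?thesis
      using xr comm_scalar_prod[OF r x(1)] by simp
  qed
  \<comment> \<open>Moving from \<open>x\<close> to \<open>x + t r\<close> changes the squared norm
    only in second order but the quadratic form by \<open>2 t (r \<bullet> r)\<close> in first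
    order. Maximality for all \<open>t\<close> thus forces \<open>r = 0\<close>.\<close>
  have quad: "0 \<le> t\<^sup>2 * (\<mu> * (r \<bullet> r) - r \<bullet> (A *\<^sub>v r)) - 2 * t * (r \<bullet> r)" for t :: real
  proof -
    let ?y = "x + t \<cdot>\<^sub>v r"
    have "?y \<bullet> (A *\<^sub>v ?y) \<le> \<mu> * (?y \<bullet> ?y)"
      using x r orth v vr by (intro hom) (auto simp: scalar_prod_add_distrib[of _ n])
    moreover have "?y \<bullet> ?y = 1 + t\<^sup>2 * (r \<bullet> r)"
      using x r xr comm_scalar_prod[OF r x(1)]
      by (simp add: scalar_prod_add_distrib[of _ n] add_scalar_prod_distrib[of _ n] power2_eq_square)
    moreover have "?y \<bullet> (A *\<^sub>v ?y) = \<mu> + 2 * t * (r \<bullet> r) + t\<^sup>2 * (r \<bullet> (A *\<^sub>v r))"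
      using x r A rAx symmetric_scalar_prod[OF A r x(1)]
      by (simp add: scalar_prod_add_distrib[of _ n] add_scalar_prod_distrib[of _ n]
          mult_add_distrib_mat_vec[of _ n n] mult_mat_vec[of _ n n] power2_eq_square \<mu>_def)
        (simp add: algebra_simps)
    ultimately show ?thesis by (simp add: algebra_simps)
  qed
  have "r \<bullet> r = 0"
  proof (rule ccontr)
    assume "r \<bullet> r \<noteq> 0"
    then have pos: "r \<bullet> r > 0" using scalar_prod_self_ge_0[of r] by linarith
    define a where "a = \<mu> * (r \<bullet> r) - r \<bullet> (A *\<^sub>v r)"
    \<comment> \<open>Small enough for the quadratic term to eat at most half of the linear one; the
      \<open>+ 1\<close> covers \<open>a = 0\<close>.\<close>
    define t where "t = (r \<bullet> r) / (\<bar>a\<bar> + 1)"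
    have "t > 0" using pos by (simp add: t_def)
    have "t * a \<le> r \<bullet> r"
    proof -
      have "t * a \<le> t * (\<bar>a\<bar> + 1)"
        using \<open>t > 0\<close> by (intro mult_left_mono) auto
      also have "\<dots> = r \<bullet> r"
        by (simp add: t_def add_nonneg_eq_0_iff)
      finally show ?thesis .
    qed
    then have "t * (t * a) \<le> t * (r \<bullet> r)"
      using \<open>t > 0\<close> by simp
    with quad[of t] \<open>t > 0\<close> pos mult_pos_pos[OF \<open>t > 0\<close> pos] show False
      by (simp add: a_def[symmetric] power2_eq_square algebra_simps)
  qed
  then have "r = 0\<^sub>v n"
    using scalar_prod_self_eq_0_iff[OF r] by simp
  have "A *\<^sub>v x = \<mu> \<cdot>\<^sub>v x"
  proof (rule eq_vecI)
    fix i assume "i < dim_vec (\<mu> \<cdot>\<^sub>v x)"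
    with \<open>r = 0\<^sub>v n\<close> x show "(A *\<^sub>v x) $ i = (\<mu> \<cdot>\<^sub>v x) $ i"
      using A by (metis Ax carrier_vecD eq_iff_diff_eq_0 index_minus_vec(1) index_smult_vec(2) index_zero_vec(1) r_def)
  qed (use A x in auto)
  then show ?thesis
    using x orth by blast
qed

section \<open>Orthonormal eigenbases and independence of the absolute value from their
  choice\<close>

definition orthonormal :: "nat \<Rightarrow> nat \<Rightarrow> (nat \<Rightarrow> real vec) \<Rightarrow> bool" where
  "orthonormal n k v \<longleftrightarrow> (\<forall>i<k. v i \<in> carrier_vec n) \<and>
     (\<forall>i<k. \<forall>j<k. v i \<bullet> v j = (if i = j then 1 else 0))"

lemma exists_orthonormal_eigenvectors:
  fixes A :: "real mat"
  assumes A: "A \<in> carrier_mat n n" "transpose_mat A = A" and "k \<le> n"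
  shows "\<exists>v l. orthonormal n k v \<and> (\<forall>i<k. A *\<^sub>v v i = l i \<cdot>\<^sub>v v i)"
  using \<open>k \<le> n\<close>
proof (induction k)
  case 0
  then show ?case by (simp add: orthonormal_def)
next
  case (Suc k)
  then obtain v l where v: "orthonormal n k v" and ev: "\<forall>i<k. A *\<^sub>v v i = l i \<cdot>\<^sub>v v i"
    by auto
  obtain x \<mu> where x: "x \<in> carrier_vec n" "x \<bullet> x = 1" "\<forall>j<k. v j \<bullet> x = 0" "A *\<^sub>v x = \<mu> \<cdot>\<^sub>v x"
    using exists_eigenvector_orthogonal[OF A, of k v l] v ev Suc.prems by (auto simp: orthonormal_def)
  have "x \<bullet> v j = 0" if "j < k" for j
    using x that v comm_scalar_prod[of x n "v j"] by (auto simp: orthonormal_def)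
  then have "orthonormal n (Suc k) (v(k := x))"
    using v x by (auto simp: orthonormal_def less_Suc_eq)
  moreover have "\<forall>i<Suc k. A *\<^sub>v (v(k := x)) i = (l(k := \<mu>)) i \<cdot>\<^sub>v (v(k := x)) i"
    using ev x by (auto simp: less_Suc_eq)
  ultimately show ?case by blast
qed

text \<open>Orthonormal rows of a square matrix give orthonormal columns, since a right inverse is
  also a left inverse.\<close>

lemma orthonormal_complete:
  assumes "orthonormal n n v" "a < n" "b < n"
  shows "(\<Sum>i<n. v i $ a * v i $ b) = (if a = b then 1 else 0)"
proof -
  define V where "V = mat n n (\<lambda>(i, j). v i $ j)"
  have V: "V \<in> carrier_mat n n" by (simp add: V_def)
  have row: "row V i = v i" if "i < n" for i
    using assms(1) that by (intro eq_vecI) (auto simp: V_def orthonormal_def)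
  have "V * transpose_mat V = 1\<^sub>m n"
    using assms(1) V by (intro eq_matI) (auto simp: row orthonormal_def)
  then have "transpose_mat V * V = 1\<^sub>m n"
    using mat_mult_left_right_inverse[OF V] V by auto
  then have "(transpose_mat V * V) $$ (a, b) = (if a = b then 1 else 0)"
    using assms by simp
  then show ?thesis
    using assms V by (simp add: scalar_prod_def V_def lessThan_atLeast0)
qed

lemma msum_outer_index:
  assumes "\<And>k. k < p \<Longrightarrow> v k \<in> carrier_vec n" "a < n" "b < n"
  shows "msum n p (\<lambda>k. l k \<cdot>\<^sub>m outer (v k)) $$ (a, b) = (\<Sum>k<p. l k * (v k $ a * v k $ b))"
proof -
  have "(l k \<cdot>\<^sub>m outer (v k)) $$ (a, b) = l k * (v k $ a * v k $ b)" if "k < p" for k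
    using assms(1)[OF that] assms(2,3) by (simp add: outer_def)
  then show ?thesis
    using assms(2,3) by (simp add: msum_def)
qed

lemma msum_carrier[simp]: "msum n p A \<in> carrier_mat n n"
  by (simp add: msum_def)

lemma msum_outer_form:
  assumes v: "\<And>k. k < p \<Longrightarrow> v k \<in> carrier_vec n" and x: "x \<in> carrier_vec n" "y \<in> carrier_vec n"
  shows "x \<bullet> (msum n p (\<lambda>k. l k \<cdot>\<^sub>m outer (v k)) *\<^sub>v y) = (\<Sum>k<p. l k * (v k \<bullet> x) * (v k \<bullet> y))"
proof -
  have "x \<bullet> (msum n p (\<lambda>k. l k \<cdot>\<^sub>m outer (v k)) *\<^sub>v y)
      = (\<Sum>i<n. \<Sum>j<n. \<Sum>k<p. l k * (v k $ i * x $ i) * (v k $ j * y $ j))"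
    using v x
    by (simp add: bilinear_form_eq_sum[of _ n] msum_outer_index sum_distrib_left sum_distrib_right mult_ac)
  also have "\<dots> = (\<Sum>i<n. \<Sum>k<p. \<Sum>j<n. l k * (v k $ i * x $ i) * (v k $ j * y $ j))"
    by (rule sum.cong[OF refl]) (rule sum.swap)
  also have "\<dots> = (\<Sum>k<p. \<Sum>i<n. \<Sum>j<n. l k * (v k $ i * x $ i) * (v k $ j * y $ j))"
    by (rule sum.swap)
  also have "\<dots> = (\<Sum>k<p. l k * (v k \<bullet> x) * (v k \<bullet> y))"
  proof (intro sum.cong refl)
    fix k
    have "l k * (v k \<bullet> x) * (v k \<bullet> y) = l k * ((\<Sum>i<n. v k $ i * x $ i) * (\<Sum>j<n. v k $ j * y $ j))"
      using x by (simp add: scalar_prod_def lessThan_atLeast0)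
    also have "\<dots> = (\<Sum>i<n. \<Sum>j<n. l k * (v k $ i * x $ i) * (v k $ j * y $ j))"
      unfolding sum_product by (simp add: sum_distrib_left mult.assoc)
    finally show "(\<Sum>i<n. \<Sum>j<n. l k * (v k $ i * x $ i) * (v k $ j * y $ j)) =
      l k * (v k \<bullet> x) * (v k \<bullet> y)" by simp
  qed
  finally show ?thesis .
qed

lemma orthonormal_expansion:
  assumes w: "orthonormal n n w" and x: "x \<in> carrier_vec n" and "b < n"
  shows "(\<Sum>j<n. (x \<bullet> w j) * w j $ b) = x $ b"
proof -
  have "(\<Sum>j<n. (x \<bullet> w j) * w j $ b) = (\<Sum>j<n. \<Sum>a<n. x $ a * (w j $ a * w j $ b))"
    using w by (auto intro!: sum.cong simp: scalar_prod_def lessThan_atLeast0 sum_distrib_right mult.assoc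
        orthonormal_def)
  also have "\<dots> = (\<Sum>a<n. x $ a * (\<Sum>j<n. w j $ a * w j $ b))"
    unfolding sum_distrib_left by (rule sum.swap)
  also have "\<dots> = x $ b"
    using \<open>b < n\<close> by (simp add: orthonormal_complete[OF w] if_distrib cong: if_cong)
  finally show ?thesis .
qed

lemma symmetric_eigendecomposition_exists:
  assumes A: "A \<in> carrier_mat n n" "transpose_mat A = A"
  shows "\<exists>l v. eigendecomposition A l v"
proof -
  obtain v l where v: "orthonormal n n v" and ev: "\<forall>i<n. A *\<^sub>v v i = l i \<cdot>\<^sub>v v i"
    using exists_orthonormal_eigenvectors[OF A, of n] by auto
  have "A $$ (a, b) = (\<Sum>i<n. l i * (v i $ a * v i $ b))" if ab: "a < n" "b < n" for a b
  proof -
    have "A $$ (a, b) = (\<Sum>c<n. A $$ (a, c) * (if c = b then 1 else 0))"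
      using ab by (simp add: if_distrib cong: if_cong)
    also have "\<dots> = (\<Sum>c<n. A $$ (a, c) * (\<Sum>i<n. v i $ c * v i $ b))"
      using orthonormal_complete[OF v] ab by simp
    also have "\<dots> = (\<Sum>i<n. (\<Sum>c<n. A $$ (a, c) * v i $ c) * v i $ b)"
      unfolding sum_distrib_left sum_distrib_right by (subst sum.swap) (simp add: mult_ac)
    also have "\<dots> = (\<Sum>i<n. (l i * v i $ a) * v i $ b)"
    proof (intro sum.cong refl, goal_cases)
      case (1 i)
      have vi: "v i \<in> carrier_vec n" using v 1 by (auto simp: orthonormal_def)
      then have "(A *\<^sub>v v i) $ a = (\<Sum>c<n. A $$ (a, c) * v i $ c)"
        using A ab by (auto simp: scalar_prod_def lessThan_atLeast0)
      with ev 1 vi ab show ?case by auto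
    qed
    finally show ?thesis by (simp add: mult_ac)
  qed
  then have "A = msum n n (\<lambda>i. l i \<cdot>\<^sub>m outer (v i))"
    using A v by (intro eq_matI) (auto simp: msum_def outer_def orthonormal_def intro!: sum.cong)
  then have "eigendecomposition A l v"
    unfolding eigendecomposition_def using carrier_matD(1)[OF A(1)] v by (simp add: orthonormal_def)
  then show ?thesis by blast
qed

text \<open>Evaluating \<open>v i \<bullet> (A *\<^sub>v w j)\<close> in both bases shows
  \<open>l i = l' j\<close> whenever \<open>v i\<close> and \<open>w j\<close> are not orthogonal,
  so the absolute values agree there too. Expanding one basis in the other transfers this to the
  matrices. This makes the \<open>THE\<close> in \<open>mat_abs\<close> well defined.\<close>

lemma eigendecomposition_abs_unique:
  assumes A: "A \<in> carrier_mat n n" and lv: "eigendecomposition A l v" and lw: "eigendecomposition A l' w"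
  shows "msum n n (\<lambda>i. \<bar>l i\<bar> \<cdot>\<^sub>m outer (v i)) = msum n n (\<lambda>i. \<bar>l' i\<bar> \<cdot>\<^sub>m outer (w i))"
proof -
  have v: "orthonormal n n v" "A = msum n n (\<lambda>i. l i \<cdot>\<^sub>m outer (v i))"
    and w: "orthonormal n n w" "A = msum n n (\<lambda>i. l' i \<cdot>\<^sub>m outer (w i))"
    using carrier_matD(1)[OF A] lv lw by (simp_all add: eigendecomposition_def orthonormal_def)
  have vc: "v i \<in> carrier_vec n" and wc: "w i \<in> carrier_vec n" if "i < n" for i
    using v w that by (auto simp: orthonormal_def)
  have eq: "\<bar>l i\<bar> * (v i \<bullet> w j) = \<bar>l' j\<bar> * (v i \<bullet> w j)" if ij: "i < n" "j < n" for i j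
  proof -
    have "v i \<bullet> (A *\<^sub>v w j) = (\<Sum>k<n. l k * (v k \<bullet> v i) * (v k \<bullet> w j))"
      using vc wc ij by (subst v(2), subst msum_outer_form) auto
    also have "\<dots> = (\<Sum>k<n. if k = i then l i * (v i \<bullet> w j) else 0)"
      using v(1) ij by (intro sum.cong) (auto simp: orthonormal_def)
    also have "\<dots> = l i * (v i \<bullet> w j)"
      using ij by simp
    finally have 1: "v i \<bullet> (A *\<^sub>v w j) = l i * (v i \<bullet> w j)" .
    have "v i \<bullet> (A *\<^sub>v w j) = (\<Sum>k<n. l' k * (w k \<bullet> v i) * (w k \<bullet> w j))"
      using vc wc ij by (subst w(2), subst msum_outer_form) auto
    also have "\<dots> = (\<Sum>k<n. if k = j then l' j * (w j \<bullet> v i) else 0)"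
      using w(1) ij by (intro sum.cong) (auto simp: orthonormal_def)
    also have "\<dots> = l' j * (v i \<bullet> w j)"
      using ij comm_scalar_prod[OF vc wc] by simp
    finally show ?thesis
      using 1 by (cases "v i \<bullet> w j = 0") auto
  qed
  show ?thesis
  proof (rule eq_matI)
    fix a b assume "a < dim_row (msum n n (\<lambda>i. \<bar>l' i\<bar> \<cdot>\<^sub>m outer (w i)))"
      "b < dim_col (msum n n (\<lambda>i. \<bar>l' i\<bar> \<cdot>\<^sub>m outer (w i)))"
    then have ab: "a < n" "b < n" by (auto simp: msum_def)
    have "msum n n (\<lambda>i. \<bar>l i\<bar> \<cdot>\<^sub>m outer (v i)) $$ (a, b) = (\<Sum>i<n. \<bar>l i\<bar> * (v i $ a * v i $ b))"
      using vc ab by (subst msum_outer_index) auto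
    also have "\<dots> = (\<Sum>i<n. \<bar>l i\<bar> * (v i $ a * (\<Sum>j<n. (v i \<bullet> w j) * w j $ b)))"
      using ab vc by (intro sum.cong refl) (simp add: orthonormal_expansion[OF w(1)])
    also have "\<dots> = (\<Sum>i<n. \<Sum>j<n. \<bar>l i\<bar> * (v i \<bullet> w j) * v i $ a * w j $ b)"
      by (simp add: sum_distrib_left mult_ac)
    also have "\<dots> = (\<Sum>i<n. \<Sum>j<n. \<bar>l' j\<bar> * (w j \<bullet> v i) * v i $ a * w j $ b)"
      using eq comm_scalar_prod[OF vc wc] by (intro sum.cong refl) auto
    also have "\<dots> = (\<Sum>j<n. \<Sum>i<n. \<bar>l' j\<bar> * (w j \<bullet> v i) * v i $ a * w j $ b)"
      by (rule sum.swap)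
    also have "\<dots> = (\<Sum>j<n. \<bar>l' j\<bar> * ((\<Sum>i<n. (w j \<bullet> v i) * v i $ a) * w j $ b))"
      by (simp add: sum_distrib_left sum_distrib_right mult_ac)
    also have "\<dots> = (\<Sum>j<n. \<bar>l' j\<bar> * (w j $ a * w j $ b))"
      using ab wc by (intro sum.cong refl) (simp add: orthonormal_expansion[OF v(1)])
    also have "\<dots> = msum n n (\<lambda>i. \<bar>l' i\<bar> \<cdot>\<^sub>m outer (w i)) $$ (a, b)"
      using wc ab by (subst msum_outer_index) auto
    finally show "msum n n (\<lambda>i. \<bar>l i\<bar> \<cdot>\<^sub>m outer (v i)) $$ (a, b) =
      msum n n (\<lambda>i. \<bar>l' i\<bar> \<cdot>\<^sub>m outer (w i)) $$ (a, b)" .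
  qed (auto simp: msum_def)
qed

lemma mat_abs_eq:
  assumes A: "A \<in> carrier_mat n n" and lv: "eigendecomposition A l v"
  shows "mat_abs A = msum n n (\<lambda>i. \<bar>l i\<bar> \<cdot>\<^sub>m outer (v i))"
  unfolding mat_abs_def
proof (rule the_equality)
  show "\<exists>l' w. eigendecomposition A l' w \<and>
      msum n n (\<lambda>i. \<bar>l i\<bar> \<cdot>\<^sub>m outer (v i)) = msum (dim_row A) (dim_row A) (\<lambda>i. \<bar>l' i\<bar> \<cdot>\<^sub>m outer (w i))"
    using lv carrier_matD(1)[OF A] by blast
next
  fix B assume "\<exists>l' w. eigendecomposition A l' w \<and> B = msum (dim_row A) (dim_row A) (\<lambda>i. \<bar>l' i\<bar> \<cdot>\<^sub>m outer (w i))"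
  then obtain l' w where "eigendecomposition A l' w" "B = msum n n (\<lambda>i. \<bar>l' i\<bar> \<cdot>\<^sub>m outer (w i))"
    unfolding carrier_matD(1)[OF A] by blast
  then show "B = msum n n (\<lambda>i. \<bar>l i\<bar> \<cdot>\<^sub>m outer (v i))"
    using eigendecomposition_abs_unique[OF A lv] by simp
qed

lemma symmetric_mat_spectral:
  assumes A: "A \<in> carrier_mat n n" "transpose_mat A = A"
  obtains l v where "orthonormal n n v" "A = msum n n (\<lambda>i. l i \<cdot>\<^sub>m outer (v i))"
    "mat_abs A = msum n n (\<lambda>i. \<bar>l i\<bar> \<cdot>\<^sub>m outer (v i))"
proof -
  obtain l v where lv: "eigendecomposition A l v"
    using symmetric_eigendecomposition_exists[OF A] by blast
  then show thesis
    using that[of v l] mat_abs_eq[OF A(1) lv] carrier_matD(1)[OF A(1)]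
    by (simp add: eigendecomposition_def orthonormal_def)
qed

section \<open>Perturbing the inverse of a positive definite matrix\<close>

lemma quadratic_nonneg_discriminant:
  fixes a b c :: real
  assumes nonneg: "\<And>t. 0 \<le> a + 2 * t * b + t\<^sup>2 * c" and "0 \<le> c"
  shows "b\<^sup>2 \<le> a * c"
proof (cases "c = 0")
  case True
  have "b = 0"
  proof (rule ccontr)
    assume "b \<noteq> 0"
    \<comment> \<open>The chosen \<open>t\<close> gives the affine function
      \<open>a + 2 * t * b\<close> the value -1.\<close>
    then show False
      using nonneg[of "- (a + 1) / (2 * b)"] True by (simp add: field_simps)
  qed
  then show ?thesis using True by simp
next
  case False
  then show ?thesis
    using nonneg[of "- b / c"] \<open>0 \<le> c\<close> by (simp add: field_simps power2_eq_square)
qed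

lemma psd_cauchy_schwarz:
  fixes Q :: "real mat"
  assumes Q: "Q \<in> carrier_mat n n" "transpose_mat Q = Q"
    and psd: "\<And>v. v \<in> carrier_vec n \<Longrightarrow> 0 \<le> v \<bullet> (Q *\<^sub>v v)"
    and x: "x \<in> carrier_vec n" "y \<in> carrier_vec n"
  shows "(x \<bullet> (Q *\<^sub>v y))\<^sup>2 \<le> (x \<bullet> (Q *\<^sub>v x)) * (y \<bullet> (Q *\<^sub>v y))"
proof (rule quadratic_nonneg_discriminant)
  fix t :: real
  have "0 \<le> (x + t \<cdot>\<^sub>v y) \<bullet> (Q *\<^sub>v (x + t \<cdot>\<^sub>v y))"
    using x by (intro psd) auto
  also have "\<dots> = x \<bullet> (Q *\<^sub>v x) + 2 * t * (x \<bullet> (Q *\<^sub>v y)) + t\<^sup>2 * (y \<bullet> (Q *\<^sub>v y))"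
    using x Q symmetric_scalar_prod[OF Q x(2,1)]
    by (simp add: scalar_prod_add_distrib[of _ n] add_scalar_prod_distrib[of _ n]
        mult_add_distrib_mat_vec[of _ n n] mult_mat_vec[of _ n n] power2_eq_square)
      (simp add: algebra_simps)
  finally show "0 \<le> x \<bullet> (Q *\<^sub>v x) + 2 * t * (x \<bullet> (Q *\<^sub>v y)) + t\<^sup>2 * (y \<bullet> (Q *\<^sub>v y))" .
qed (use psd x in auto)

definition pos_def :: "nat \<Rightarrow> real mat \<Rightarrow> bool" where
  "pos_def n Z \<longleftrightarrow> Z \<in> carrier_mat n n \<and> transpose_mat Z = Z \<and>
     (\<forall>v \<in> carrier_vec n. v \<noteq> 0\<^sub>v n \<longrightarrow> 0 < v \<bullet> (Z *\<^sub>v v))"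

text \<open>A relation that also records positive definiteness of \<open>Z\<close>, so that a single
  fact per barrier serves as the invariant of the walk.\<close>

definition pos_def_inverse :: "nat \<Rightarrow> real mat \<Rightarrow> real mat \<Rightarrow> bool" where
  "pos_def_inverse n Z M \<longleftrightarrow> pos_def n Z \<and> M \<in> carrier_mat n n \<and> Z * M = 1\<^sub>m n \<and> M * Z = 1\<^sub>m n"

text \<open>The trace, written as a sum of quadratic forms so that bounds between forms can be
  summed directly.\<close>

definition tr :: "nat \<Rightarrow> real mat \<Rightarrow> real" where
  "tr n M = (\<Sum>i<n. unit_vec n i \<bullet> (M *\<^sub>v unit_vec n i))"

text \<open>For symmetric \<open>M\<close> this is the trace of \<open>M^2\<close>: the rate at
  which the trace of the inverse decreases when a multiple of the identity is added to the
  matrix.\<close>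

definition tr_square :: "nat \<Rightarrow> real mat \<Rightarrow> real" where
  "tr_square n M = (\<Sum>i<n. (M *\<^sub>v unit_vec n i) \<bullet> (M *\<^sub>v unit_vec n i))"

lemma pos_def_inverse_exists:
  assumes Z: "pos_def n Z"
  shows "\<exists>M. pos_def_inverse n Z M"
proof -
  have Zc: "Z \<in> carrier_mat n n" using Z by (simp add: pos_def_def)
  have "det Z \<noteq> 0"
  proof
    assume "det Z = 0"
    then obtain v where "v \<in> carrier_vec n" "v \<noteq> 0\<^sub>v n" "Z *\<^sub>v v = 0\<^sub>v n"
      using det_0_iff_vec_prod_zero_field[OF Zc] by auto
    then show False using Z by (force simp: pos_def_def)
  qed
  from det_non_zero_imp_unit[OF Zc this, of "()"] obtain M where
    "M \<in> carrier_mat n n" "M * Z = 1\<^sub>m n" "Z * M = 1\<^sub>m n"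
    by (auto simp: Units_def ring_mat_def)
  then show ?thesis using Z by (auto simp: pos_def_inverse_def)
qed

lemma mult_mat_zero_vec:
  "(A :: real mat) \<in> carrier_mat nr nc \<Longrightarrow> A *\<^sub>v 0\<^sub>v nc = 0\<^sub>v nr"
  by (intro eq_vecI) auto

section \<open>Quadratic forms of a positive definite matrix and of its inverse\<close>

context
  fixes n :: nat and Z M :: "real mat"
  assumes ZM: "pos_def_inverse n Z M"
begin

lemma pdi_carrier: "Z \<in> carrier_mat n n" "M \<in> carrier_mat n n" "transpose_mat Z = Z"
  using ZM by (auto simp: pos_def_inverse_def pos_def_def)

lemma pdi_carrier_vec: "v \<in> carrier_vec n \<Longrightarrow> Z *\<^sub>v v \<in> carrier_vec n"
  "v \<in> carrier_vec n \<Longrightarrow> M *\<^sub>v v \<in> carrier_vec n"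
  using pdi_carrier by auto

lemma pdi_symmetric: "transpose_mat M = M"
proof -
  have MT: "transpose_mat M \<in> carrier_mat n n" using pdi_carrier by simp
  have "transpose_mat (Z * M) = 1\<^sub>m n" using ZM by (simp add: pos_def_inverse_def)
  then have "transpose_mat M * Z = 1\<^sub>m n"
    using pdi_carrier transpose_mult[of Z n n M n] by simp
  then have "transpose_mat M * Z * M = M" using pdi_carrier by simp
  moreover have "transpose_mat M * Z * M = transpose_mat M * (Z * M)"
    using MT pdi_carrier by (intro assoc_mult_mat) auto
  moreover have "Z * M = 1\<^sub>m n" using ZM by (simp add: pos_def_inverse_def)
  ultimately show ?thesis using MT by simp
qed

lemma pdi_cancel:
  assumes "v \<in> carrier_vec n"
  shows "Z *\<^sub>v (M *\<^sub>v v) = v" "M *\<^sub>v (Z *\<^sub>v v) = v"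
  using assms ZM assoc_mult_mat_vec[OF pdi_carrier(1,2) assms] assoc_mult_mat_vec[OF pdi_carrier(2,1) assms]
  unfolding pos_def_inverse_def by (metis one_mult_mat_vec)+

lemma pdi_nonneg: "v \<in> carrier_vec n \<Longrightarrow> 0 \<le> v \<bullet> (Z *\<^sub>v v)"
  using ZM pdi_carrier by (cases "v = 0\<^sub>v n") (auto simp: pos_def_inverse_def pos_def_def less_imp_le)

lemma pdi_form_inverse:
  assumes "v \<in> carrier_vec n"
  shows "v \<bullet> (M *\<^sub>v v) = (M *\<^sub>v v) \<bullet> (Z *\<^sub>v (M *\<^sub>v v))"
  using assms pdi_cancel[OF assms] pdi_carrier_vec[OF assms] comm_scalar_prod[of v n "M *\<^sub>v v"] by simp

lemma pdi_inverse_nonneg: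
  assumes "v \<in> carrier_vec n"
  shows "0 \<le> v \<bullet> (M *\<^sub>v v)"
  using assms pdi_form_inverse pdi_nonneg pdi_carrier_vec by simp

lemma pdi_inverse_pos:
  assumes v: "v \<in> carrier_vec n" "v \<noteq> 0\<^sub>v n"
  shows "0 < v \<bullet> (M *\<^sub>v v)" "M *\<^sub>v v \<noteq> 0\<^sub>v n"
proof -
  show "M *\<^sub>v v \<noteq> 0\<^sub>v n"
    using pdi_cancel(1)[OF v(1)] v mult_mat_zero_vec[OF pdi_carrier(1)] by metis
  then show "0 < v \<bullet> (M *\<^sub>v v)"
    using ZM pdi_carrier_vec[OF v(1)] pdi_form_inverse[OF v(1)] by (simp add: pos_def_inverse_def pos_def_def)
qed

text \<open>The norms defined by \<open>Z\<close> and by its inverse \<open>M\<close> are dual: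
  \<open>x \<bullet> y\<close> equals \<open>(M *\<^sub>v x) \<bullet> (Z *\<^sub>v y)\<close>, to
  which Cauchy-Schwarz for \<open>Z\<close> applies.\<close>

lemma pdi_scalar_prod_sq_le:
  assumes "x \<in> carrier_vec n" "y \<in> carrier_vec n"
  shows "(x \<bullet> y)\<^sup>2 \<le> (x \<bullet> (M *\<^sub>v x)) * (y \<bullet> (Z *\<^sub>v y))"
proof -
  have "(x \<bullet> y)\<^sup>2 = ((M *\<^sub>v x) \<bullet> (Z *\<^sub>v y))\<^sup>2"
    using assms pdi_carrier pdi_carrier_vec symmetric_scalar_prod[of Z n "M *\<^sub>v x" y]
      comm_scalar_prod[of x n y]
    by (simp add: pdi_cancel)
  also have "\<dots> \<le> ((M *\<^sub>v x) \<bullet> (Z *\<^sub>v (M *\<^sub>v x))) * (y \<bullet> (Z *\<^sub>v y))"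
    using assms pdi_carrier pdi_carrier_vec pdi_nonneg by (intro psd_cauchy_schwarz[of Z n]) auto
  also have "\<dots> = (x \<bullet> (M *\<^sub>v x)) * (y \<bullet> (Z *\<^sub>v y))"
    using assms pdi_form_inverse by simp
  finally show ?thesis .
qed

text \<open>With \<open>y = M v\<close> and \<open>r = M' v - y\<close> one has \<open>(Z - D) r = D y\<close>, so the exact second-order term is
  \<open>(D y) \<bullet> M' (D y)\<close>, and \<open>M' \<preceq> 2 M\<close> by the assumption.\<close>

lemma pdi_perturb:
  assumes D: "D \<in> carrier_mat n n" "transpose_mat D = D"
    and half: "\<And>v. v \<in> carrier_vec n \<Longrightarrow> v \<bullet> (Z *\<^sub>v v) \<le> 2 * (v \<bullet> ((Z - D) *\<^sub>v v))"
  shows "\<exists>M'. pos_def_inverse n (Z - D) M' \<and> (\<forall>v \<in> carrier_vec n. v \<bullet> (M' *\<^sub>v v) \<le>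
    v \<bullet> (M *\<^sub>v v) + (M *\<^sub>v v) \<bullet> (D *\<^sub>v (M *\<^sub>v v)) +
    2 * ((D *\<^sub>v (M *\<^sub>v v)) \<bullet> (M *\<^sub>v (D *\<^sub>v (M *\<^sub>v v)))))"
proof -
  note c = pdi_carrier
  have Z'sym: "transpose_mat (Z - D) = Z - D"
    using c D transpose_minus[of Z n n D] by simp
  have "pos_def n (Z - D)"
    unfolding pos_def_def
  proof (intro conjI ballI impI)
    fix v :: "real vec" assume v: "v \<in> carrier_vec n" "v \<noteq> 0\<^sub>v n"
    then have "0 < v \<bullet> (Z *\<^sub>v v)" using ZM by (simp add: pos_def_inverse_def pos_def_def)
    then show "0 < v \<bullet> ((Z - D) *\<^sub>v v)" using half[OF v(1)] by linarith
  qed (use c D Z'sym in auto)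
  then obtain M' where M': "pos_def_inverse n (Z - D) M'"
    using pos_def_inverse_exists by blast
  note c' = Submission.pdi_carrier[OF M'] Submission.pdi_carrier_vec[OF M']
  \<comment> \<open>Inversion reverses the order \<open>Z \<preceq> 2 (Z - D)\<close>. Without
    square roots of matrices: duality bounds \<open>(d \<bullet> p)^2\<close> by a multiple of
    \<open>d \<bullet> p\<close> itself, which is then cancelled.\<close>
  have double: "d \<bullet> (M' *\<^sub>v d) \<le> 2 * (d \<bullet> (M *\<^sub>v d))" if d: "d \<in> carrier_vec n" for d
  proof -
    let ?p = "M' *\<^sub>v d"
    have p: "?p \<in> carrier_vec n" using c' d by simp
    have "(d \<bullet> ?p)\<^sup>2 \<le> (d \<bullet> (M *\<^sub>v d)) * (?p \<bullet> (Z *\<^sub>v ?p))"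
      by (rule pdi_scalar_prod_sq_le[OF d p])
    also have "\<dots> \<le> (d \<bullet> (M *\<^sub>v d)) * (2 * (d \<bullet> ?p))"
      using half[OF p] Submission.pdi_form_inverse[OF M' d] pdi_inverse_nonneg[OF d]
      by (intro mult_left_mono) auto
    finally have "(d \<bullet> ?p) * (d \<bullet> ?p) \<le> (2 * (d \<bullet> (M *\<^sub>v d))) * (d \<bullet> ?p)"
      by (simp add: power2_eq_square mult_ac)
    then show ?thesis
      using Submission.pdi_inverse_nonneg[OF M' d] pdi_inverse_nonneg[OF d]
      by (cases "d \<bullet> ?p = 0") (auto simp: mult_le_cancel_right)
  qed
  have "v \<bullet> (M' *\<^sub>v v) \<le> v \<bullet> (M *\<^sub>v v) + (M *\<^sub>v v) \<bullet> (D *\<^sub>v (M *\<^sub>v v)) +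
    2 * ((D *\<^sub>v (M *\<^sub>v v)) \<bullet> (M *\<^sub>v (D *\<^sub>v (M *\<^sub>v v))))" if v: "v \<in> carrier_vec n" for v
  proof -
    define y where "y = M *\<^sub>v v"
    define d where "d = D *\<^sub>v y"
    have y: "y \<in> carrier_vec n" and d: "d \<in> carrier_vec n"
      using v c D by (auto simp: y_def d_def)
    let ?r = "M' *\<^sub>v d"
    have r: "?r \<in> carrier_vec n" using c' d by simp
    have "(Z - D) *\<^sub>v (y + ?r) = (Z - D) *\<^sub>v y + d"
      using y r c c' D Submission.pdi_cancel(1)[OF M' d] by (subst mult_add_distrib_mat_vec[of _ n n]) auto
    also have "\<dots> = v"
      using y d v c D pdi_cancel(1)[OF v] unfolding d_def y_def
      by (subst minus_mult_distrib_mat_vec[of _ n n]) auto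
    finally have "M' *\<^sub>v ((Z - D) *\<^sub>v (y + ?r)) = M' *\<^sub>v v" by simp
    then have M'v: "M' *\<^sub>v v = y + ?r"
      using Submission.pdi_cancel(2)[OF M', of "y + ?r"] y r by simp
    have "v \<bullet> ?r = d \<bullet> (M' *\<^sub>v v)"
      using symmetric_scalar_prod[OF c'(2) Submission.pdi_symmetric[OF M'] v d] .
    also have "\<dots> = d \<bullet> y + d \<bullet> ?r"
      unfolding M'v using y d r by (intro scalar_prod_add_distrib) auto
    finally have "v \<bullet> (M' *\<^sub>v v) = v \<bullet> y + d \<bullet> y + d \<bullet> ?r"
      unfolding M'v using v y r by (subst scalar_prod_add_distrib) auto
    then show ?thesis
      using double[OF d] comm_scalar_prod[OF d y] by (simp add: d_def y_def)
  qed
  then show ?thesis using M' by blast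
qed

end

section \<open>Trace bounds for a move combined with a barrier shift\<close>

lemma scalar_prod_eq_sum_sq:
  fixes x :: "real vec"
  assumes "x \<in> carrier_vec n"
  shows "x \<bullet> x = (\<Sum>i<n. (x \<bullet> unit_vec n i)\<^sup>2)"
  using assms by (auto simp: scalar_prod_def[of x x] lessThan_atLeast0 power2_eq_square intro!: sum.cong)

lemma smult_mat_mult_vec:
  fixes A :: "real mat"
  assumes "A \<in> carrier_mat nr nc" "x \<in> carrier_vec nc"
  shows "(k \<cdot>\<^sub>m A) *\<^sub>v x = k \<cdot>\<^sub>v (A *\<^sub>v x)"
  using assms by (intro eq_vecI) (auto simp: scalar_prod_def sum_distrib_left mult.assoc)

context
  fixes n :: nat and Z M :: "real mat"
  assumes ZM: "pos_def_inverse n Z M"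
begin

lemmas pdi = pdi_carrier[OF ZM] pdi_carrier_vec[OF ZM] pdi_symmetric[OF ZM]

text \<open>The hypothesis \<open>comb\<close> says that \<open>w\<close> is the combination of the
  \<open>v j\<close> with coefficients \<open>l j * q j\<close>, tested against vectors. Two uses
  matter: the standard basis, giving \<open>pdi_form_le_trace\<close>, and
  \<open>w = A *\<^sub>v y\<close>, where \<open>q j\<close> is
  \<open>v j \<bullet> y\<close>.\<close>

lemma pdi_form_combination_le:
  assumes w: "w \<in> carrier_vec n" and v: "\<And>j. j < p \<Longrightarrow> v j \<in> carrier_vec n"
    and comb: "\<And>z. z \<in> carrier_vec n \<Longrightarrow> z \<bullet> w = (\<Sum>j<p. l j * (v j \<bullet> z) * q j)"
  shows "w \<bullet> (M *\<^sub>v w) \<le> (\<Sum>j<p. \<bar>l j\<bar> * (v j \<bullet> (M *\<^sub>v v j))) * (\<Sum>j<p. \<bar>l j\<bar> * (q j)\<^sup>2)"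
proof -
  define z where "z = M *\<^sub>v w"
  define Q where "Q = w \<bullet> z"
  define \<alpha> where "\<alpha> = (\<Sum>j<p. \<bar>l j\<bar> * (v j \<bullet> (M *\<^sub>v v j)))"
  define S where "S = (\<Sum>j<p. \<bar>l j\<bar> * (q j)\<^sup>2)"
  have z: "z \<in> carrier_vec n" using w pdi by (simp add: z_def)
  have Q0: "Q \<ge> 0" unfolding Q_def z_def by (rule pdi_inverse_nonneg[OF ZM w])
  have S0: "S \<ge> 0" unfolding S_def by (intro sum_nonneg) auto
  have \<alpha>0: "\<alpha> \<ge> 0"
    unfolding \<alpha>_def by (intro sum_nonneg mult_nonneg_nonneg pdi_inverse_nonneg[OF ZM]) (auto simp: v)
  have "Q = (\<Sum>j<p. l j * (v j \<bullet> z) * q j)"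
    unfolding Q_def using comb[OF z] comm_scalar_prod[OF w z] by simp
  \<comment> \<open>With the weight split evenly, Cauchy-Schwarz sees only absolute values. A second
    Cauchy-Schwarz, for the form of \<open>M\<close>, bounds
    \<open>(v j \<bullet> z)\<^sup>2\<close> by a multiple of \<open>Q\<close>, so one factor
    \<open>Q\<close> cancels.\<close>
  also have "\<dots> = (\<Sum>j<p. (sgn (l j) * sqrt \<bar>l j\<bar> * (v j \<bullet> z)) * (sqrt \<bar>l j\<bar> * q j))"
  proof (intro sum.cong refl)
    fix j
    have "(sgn (l j) * sqrt \<bar>l j\<bar> * (v j \<bullet> z)) * (sqrt \<bar>l j\<bar> * q j)
      = (sgn (l j) * (sqrt \<bar>l j\<bar> * sqrt \<bar>l j\<bar>)) * (v j \<bullet> z) * q j"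
      by (simp only: mult_ac)
    also have "sgn (l j) * (sqrt \<bar>l j\<bar> * sqrt \<bar>l j\<bar>) = l j"
      by (simp add: sgn_mult_abs)
    finally show "l j * (v j \<bullet> z) * q j = (sgn (l j) * sqrt \<bar>l j\<bar> * (v j \<bullet> z)) * (sqrt \<bar>l j\<bar> * q j)"
      by (simp only:)
  qed
  finally have "Q\<^sup>2 \<le> (\<Sum>j<p. (sgn (l j) * sqrt \<bar>l j\<bar> * (v j \<bullet> z))\<^sup>2) * (\<Sum>j<p. (sqrt \<bar>l j\<bar> * q j)\<^sup>2)"
    by (simp add: Cauchy_Schwarz_ineq_sum)
  also have "(\<Sum>j<p. (sqrt \<bar>l j\<bar> * q j)\<^sup>2) = S"
    by (simp add: S_def power_mult_distrib)
  also have "(\<Sum>j<p. (sgn (l j) * sqrt \<bar>l j\<bar> * (v j \<bullet> z))\<^sup>2) = (\<Sum>j<p. \<bar>l j\<bar> * (v j \<bullet> z)\<^sup>2)"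
    by (intro sum.cong refl) (simp add: power_mult_distrib sgn_if)
  also have "\<dots> \<le> (\<Sum>j<p. \<bar>l j\<bar> * ((v j \<bullet> (M *\<^sub>v v j)) * Q))"
  proof (intro sum_mono mult_left_mono)
    fix j assume "j \<in> {..<p}"
    then have vj: "v j \<in> carrier_vec n" using v by auto
    show "(v j \<bullet> z)\<^sup>2 \<le> (v j \<bullet> (M *\<^sub>v v j)) * Q"
      unfolding z_def Q_def using pdi w vj pdi_inverse_nonneg[OF ZM]
      by (intro psd_cauchy_schwarz) auto
  qed auto
  also have "\<dots> = \<alpha> * Q" unfolding \<alpha>_def sum_distrib_right by (simp only: mult_ac)
  finally have "Q * Q \<le> (\<alpha> * S) * Q"
    using S0 by (simp add: mult_right_mono power2_eq_square mult_ac)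
  then have "Q \<le> \<alpha> * S"
    using Q0 \<alpha>0 S0 by (cases "Q = 0") (auto simp: mult_le_cancel_right)
  then show ?thesis by (simp add: Q_def z_def \<alpha>_def S_def)
qed

text \<open>The largest eigenvalue is at most the trace, obtained without diagonalizing
  \<open>M\<close>.\<close>

lemma pdi_form_le_trace:
  assumes y: "y \<in> carrier_vec n"
  shows "y \<bullet> (M *\<^sub>v y) \<le> tr n M * (y \<bullet> y)"
proof -
  have "y \<bullet> (M *\<^sub>v y) \<le> (\<Sum>j<n. \<bar>1\<bar> * (unit_vec n j \<bullet> (M *\<^sub>v unit_vec n j))) * (\<Sum>j<n. \<bar>1\<bar> * (y $ j)\<^sup>2)"
    using y by (intro pdi_form_combination_le) (auto simp: scalar_prod_def[of _ y] lessThan_atLeast0)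
  then show ?thesis
    using y by (simp add: tr_def scalar_prod_def[of y y] power2_eq_square lessThan_atLeast0)
qed

lemma tr_pos: "0 < n \<Longrightarrow> 0 < tr n M" "0 < n \<Longrightarrow> 0 < tr_square n M"
proof -
  assume n: "0 < n"
  have nz: "unit_vec n i \<noteq> (0\<^sub>v n :: real vec)" if "i < n" for i
    using that by (metis index_unit_vec(1) index_zero_vec(1) zero_neq_one)
  show "0 < tr n M"
    unfolding tr_def using n nz by (intro sum_pos pdi_inverse_pos[OF ZM]) auto
  have "0 < (M *\<^sub>v unit_vec n i) \<bullet> (M *\<^sub>v unit_vec n i)" if "i < n" for i
    using pdi_inverse_pos(2)[OF ZM _ nz[OF that]] pdi(5)[of "unit_vec n i"]
      scalar_prod_self_eq_0_iff[of "M *\<^sub>v unit_vec n i" n] scalar_prod_self_ge_0[of "M *\<^sub>v unit_vec n i"]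
    by force
  then show "0 < tr_square n M"
    unfolding tr_square_def using n by (intro sum_pos) auto
qed

text \<open>Rewrites a squared norm of \<open>M *\<^sub>v v\<close> as values of the rank-one form
  of \<open>v\<close> at the columns of \<open>M\<close>; sums over eigenvectors and over columns
  can then be exchanged.\<close>

lemma norm_inverse_image_eq:
  assumes "v \<in> carrier_vec n"
  shows "(M *\<^sub>v v) \<bullet> (M *\<^sub>v v) = (\<Sum>i<n. (v \<bullet> (M *\<^sub>v unit_vec n i))\<^sup>2)"
proof -
  have "unit_vec n i \<bullet> (M *\<^sub>v v) = v \<bullet> (M *\<^sub>v unit_vec n i)" for i
    using pdi assms by (intro symmetric_scalar_prod) auto
  then show ?thesis
    using scalar_prod_eq_sum_sq[OF pdi(5)[OF assms]] comm_scalar_prod[OF pdi(5)[OF assms] unit_vec_carrier]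
    by simp
qed

text \<open>Sums \<open>pdi_perturb\<close> over the standard basis for
  \<open>D = s A - \<delta> I\<close>. Everything linear in \<open>s\<close> is collected in
  \<gamma>, which is chosen before \<open>s\<close>; this order of quantifiers is what lets the
  linear term cancel between \<open>s\<close> and \<open>- s\<close>.\<close>

lemma pdi_barrier_step:
  fixes l :: "nat \<Rightarrow> real" and v :: "nat \<Rightarrow> real vec" and A :: "real mat" and \<delta> :: real
  assumes v: "\<And>j. j < p \<Longrightarrow> v j \<in> carrier_vec n" and A: "A \<in> carrier_mat n n" "transpose_mat A = A"
    and A_eq: "A = msum n p (\<lambda>j. l j \<cdot>\<^sub>m outer (v j))" and "0 \<le> \<delta>"
  defines "\<alpha> \<equiv> \<Sum>j<p. \<bar>l j\<bar> * (v j \<bullet> (M *\<^sub>v v j))"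
    and "\<beta> \<equiv> \<Sum>j<p. \<bar>l j\<bar> * ((M *\<^sub>v v j) \<bullet> (M *\<^sub>v v j))"
  shows "\<exists>\<gamma>. \<forall>s. \<bar>s\<bar> * \<alpha> \<le> 1 / 2 \<longrightarrow> (\<exists>M'. pos_def_inverse n (Z - (s \<cdot>\<^sub>m A - \<delta> \<cdot>\<^sub>m 1\<^sub>m n)) M' \<and>
    tr n M' \<le> tr n M + s * \<gamma> - \<delta> * tr_square n M + 2 * s\<^sup>2 * (\<alpha> * \<beta>) + 2 * \<delta>\<^sup>2 * (tr n M * tr_square n M))"
proof -
  define y where "y i = M *\<^sub>v unit_vec n i" for i
  have y: "y i \<in> carrier_vec n" for i using pdi by (simp add: y_def)
  \<comment> \<open>First-order effect of \<open>A\<close>, plus the mixed term of the second order: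
    \<open>- 2 * s * \<delta>\<close> from expanding the square, doubled by the factor 2 in
    \<open>pdi_perturb\<close>.\<close>
  define \<gamma> where "\<gamma> = (\<Sum>i<n. y i \<bullet> (A *\<^sub>v y i) - 4 * \<delta> * ((A *\<^sub>v y i) \<bullet> (M *\<^sub>v y i)))"
  have form: "x \<bullet> (A *\<^sub>v z) = (\<Sum>j<p. l j * (v j \<bullet> x) * (v j \<bullet> z))"
    if "x \<in> carrier_vec n" "z \<in> carrier_vec n" for x z
    unfolding A_eq using v that by (rule msum_outer_form)
  have Ac: "A *\<^sub>v x \<in> carrier_vec n" if "x \<in> carrier_vec n" for x using A that by simp
  \<comment> \<open>This is \<open>- \<alpha> Z \<preceq> A \<preceq> \<alpha> Z\<close>, so
    \<open>\<bar>s\<bar> * \<alpha> \<le> 1 / 2\<close> supplies the halving hypothesis of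
    \<open>pdi_perturb\<close>; the shift by \<delta> only helps.\<close>
  have rel: "\<bar>x \<bullet> (A *\<^sub>v x)\<bar> \<le> \<alpha> * (x \<bullet> (Z *\<^sub>v x))" if x: "x \<in> carrier_vec n" for x
  proof -
    have "\<bar>x \<bullet> (A *\<^sub>v x)\<bar> \<le> (\<Sum>j<p. \<bar>l j * (v j \<bullet> x) * (v j \<bullet> x)\<bar>)"
      unfolding form[OF x x] by (rule sum_abs)
    also have "\<dots> = (\<Sum>j<p. \<bar>l j\<bar> * (v j \<bullet> x)\<^sup>2)"
      by (simp add: abs_mult power2_eq_square mult.assoc)
    also have "\<dots> \<le> (\<Sum>j<p. \<bar>l j\<bar> * ((v j \<bullet> (M *\<^sub>v v j)) * (x \<bullet> (Z *\<^sub>v x))))"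
      using v x by (intro sum_mono mult_left_mono pdi_scalar_prod_sq_le[OF ZM]) auto
    finally show ?thesis unfolding \<alpha>_def sum_distrib_right by (simp only: mult_ac)
  qed
  have AMA: "(\<Sum>i<n. (A *\<^sub>v y i) \<bullet> (M *\<^sub>v (A *\<^sub>v y i))) \<le> \<alpha> * \<beta>"
  proof -
    have "(\<Sum>i<n. (A *\<^sub>v y i) \<bullet> (M *\<^sub>v (A *\<^sub>v y i))) \<le> (\<Sum>i<n. \<alpha> * (\<Sum>j<p. \<bar>l j\<bar> * (v j \<bullet> y i)\<^sup>2))"
      unfolding \<alpha>_def using v Ac y form by (intro sum_mono pdi_form_combination_le) auto
    also have "\<dots> = \<alpha> * (\<Sum>i<n. \<Sum>j<p. \<bar>l j\<bar> * (v j \<bullet> y i)\<^sup>2)"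
      by (simp add: sum_distrib_left)
    also have "(\<Sum>i<n. \<Sum>j<p. \<bar>l j\<bar> * (v j \<bullet> y i)\<^sup>2) = (\<Sum>j<p. \<Sum>i<n. \<bar>l j\<bar> * (v j \<bullet> y i)\<^sup>2)"
      by (rule sum.swap)
    also have "\<dots> = \<beta>"
      unfolding \<beta>_def using v
      by (intro sum.cong refl) (simp add: norm_inverse_image_eq y_def sum_distrib_left)
    finally show ?thesis .
  qed
  have MMM: "(\<Sum>i<n. y i \<bullet> (M *\<^sub>v y i)) \<le> tr n M * tr_square n M"
    unfolding tr_square_def sum_distrib_left y_def[symmetric]
    using y by (intro sum_mono pdi_form_le_trace) auto
  show ?thesis
  proof (intro exI[of _ \<gamma>] allI impI)
    fix s assume s: "\<bar>s\<bar> * \<alpha> \<le> 1 / 2"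
    define D where "D = s \<cdot>\<^sub>m A - \<delta> \<cdot>\<^sub>m 1\<^sub>m n"
    have D: "D \<in> carrier_mat n n" unfolding D_def by (intro minus_carrier_mat smult_carrier_mat one_carrier_mat)
    have Dsym: "transpose_mat D = D"
    proof -
      have "A $$ (i, j) = A $$ (j, i)" if "i < n" "j < n" for i j
        using A that by (metis carrier_matD index_transpose_mat(1))
      then show ?thesis using A by (intro eq_matI) (auto simp: D_def)
    qed
    have Dx: "D *\<^sub>v x = s \<cdot>\<^sub>v (A *\<^sub>v x) - \<delta> \<cdot>\<^sub>v x" if x: "x \<in> carrier_vec n" for x
      unfolding D_def using A x
      by (subst minus_mult_distrib_mat_vec[of _ n n]) (auto simp: smult_mat_mult_vec[of _ n n])
    have xD: "z \<bullet> (D *\<^sub>v x) = s * (z \<bullet> (A *\<^sub>v x)) - \<delta> * (z \<bullet> x)"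
      if x: "x \<in> carrier_vec n" "z \<in> carrier_vec n" for x z
      unfolding Dx[OF x(1)] using x Ac by (subst scalar_prod_minus_distrib[of _ n]) auto
    have "x \<bullet> (Z *\<^sub>v x) \<le> 2 * (x \<bullet> ((Z - D) *\<^sub>v x))" if x: "x \<in> carrier_vec n" for x
    proof -
      have "x \<bullet> ((Z - D) *\<^sub>v x) = x \<bullet> (Z *\<^sub>v x) - (s * (x \<bullet> (A *\<^sub>v x)) - \<delta> * (x \<bullet> x))"
        using x pdi D by (subst minus_mult_distrib_mat_vec[of _ n n], auto)
          (subst scalar_prod_minus_distrib[of _ n], auto simp: xD)
      moreover have "s * (x \<bullet> (A *\<^sub>v x)) \<le> \<bar>s\<bar> * (\<alpha> * (x \<bullet> (Z *\<^sub>v x)))"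
        using rel[OF x] by (metis abs_ge_self abs_ge_zero abs_mult mult_left_mono order_trans)
      moreover have "\<bar>s\<bar> * (\<alpha> * (x \<bullet> (Z *\<^sub>v x))) \<le> 1 / 2 * (x \<bullet> (Z *\<^sub>v x))"
        unfolding mult.assoc[symmetric] using s pdi_nonneg[OF ZM x] by (intro mult_right_mono) auto
      moreover have "0 \<le> \<delta> * (x \<bullet> x)" using \<open>0 \<le> \<delta>\<close> scalar_prod_self_ge_0 by simp
      ultimately show ?thesis by linarith
    qed
    from pdi_perturb[OF ZM D Dsym this] obtain M' where M': "pos_def_inverse n (Z - D) M'"
      and le: "\<And>x. x \<in> carrier_vec n \<Longrightarrow> x \<bullet> (M' *\<^sub>v x) \<le> x \<bullet> (M *\<^sub>v x) + (M *\<^sub>v x) \<bullet> (D *\<^sub>v (M *\<^sub>v x)) +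
        2 * ((D *\<^sub>v (M *\<^sub>v x)) \<bullet> (M *\<^sub>v (D *\<^sub>v (M *\<^sub>v x))))"
      by blast
    have DMD: "(D *\<^sub>v x) \<bullet> (M *\<^sub>v (D *\<^sub>v x)) = s\<^sup>2 * ((A *\<^sub>v x) \<bullet> (M *\<^sub>v (A *\<^sub>v x)))
        - 2 * s * \<delta> * ((A *\<^sub>v x) \<bullet> (M *\<^sub>v x)) + \<delta>\<^sup>2 * (x \<bullet> (M *\<^sub>v x))" if x: "x \<in> carrier_vec n" for x
    proof -
      let ?a = "A *\<^sub>v x"
      have a: "?a \<in> carrier_vec n" using Ac x by simp
      have sym: "x \<bullet> (M *\<^sub>v ?a) = ?a \<bullet> (M *\<^sub>v x)"
        using pdi x a by (intro symmetric_scalar_prod) auto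
      have "M *\<^sub>v (D *\<^sub>v x) = s \<cdot>\<^sub>v (M *\<^sub>v ?a) - \<delta> \<cdot>\<^sub>v (M *\<^sub>v x)"
        unfolding Dx[OF x] using a x pdi
        by (simp add: mult_minus_distrib_mat_vec[of _ n n] mult_mat_vec[of _ n n])
      then show ?thesis
        unfolding Dx[OF x] using a x pdi sym
        by (simp add: minus_scalar_prod_distrib[of _ n] scalar_prod_minus_distrib[of _ n] power2_eq_square)
          (simp add: algebra_simps)
    qed
    have "tr n M' \<le> (\<Sum>i<n. unit_vec n i \<bullet> (M *\<^sub>v unit_vec n i) + y i \<bullet> (D *\<^sub>v y i) +
        2 * ((D *\<^sub>v y i) \<bullet> (M *\<^sub>v (D *\<^sub>v y i))))"
      unfolding tr_def y_def by (intro sum_mono le) auto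
    also have "\<dots> = (\<Sum>i<n. unit_vec n i \<bullet> (M *\<^sub>v unit_vec n i) +
        s * (y i \<bullet> (A *\<^sub>v y i) - 4 * \<delta> * ((A *\<^sub>v y i) \<bullet> (M *\<^sub>v y i))) - \<delta> * (y i \<bullet> y i) +
        2 * s\<^sup>2 * ((A *\<^sub>v y i) \<bullet> (M *\<^sub>v (A *\<^sub>v y i))) + 2 * \<delta>\<^sup>2 * (y i \<bullet> (M *\<^sub>v y i)))"
      using y by (intro sum.cong refl) (simp add: xD DMD algebra_simps)
    also have "\<dots> = tr n M + s * \<gamma> - \<delta> * tr_square n M +
        2 * s\<^sup>2 * (\<Sum>i<n. (A *\<^sub>v y i) \<bullet> (M *\<^sub>v (A *\<^sub>v y i))) + 2 * \<delta>\<^sup>2 * (\<Sum>i<n. y i \<bullet> (M *\<^sub>v y i))"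
      by (simp add: sum.distrib sum_subtractf tr_def tr_square_def \<gamma>_def y_def sum_distrib_left
          right_diff_distrib)
    also have "\<dots> \<le> tr n M + s * \<gamma> - \<delta> * tr_square n M + 2 * s\<^sup>2 * (\<alpha> * \<beta>) + 2 * \<delta>\<^sup>2 * (tr n M * tr_square n M)"
      using AMA MMM by (intro add_mono mult_left_mono) auto
    finally show "\<exists>M'. pos_def_inverse n (Z - (s \<cdot>\<^sub>m A - \<delta> \<cdot>\<^sub>m 1\<^sub>m n)) M' \<and>
      tr n M' \<le> tr n M + s * \<gamma> - \<delta> * tr_square n M + 2 * s\<^sup>2 * (\<alpha> * \<beta>) + 2 * \<delta>\<^sup>2 * (tr n M * tr_square n M)"
      using M' unfolding D_def by blast
  qed
qed

end

section \<open>The barrier walk\<close>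

text \<open>A sign pattern is encoded by the set \<open>P\<close> of its negative coordinates.\<close>

definition sgn_of :: "nat set \<Rightarrow> nat \<Rightarrow> real" where
  "sgn_of P i = (if i \<in> P then - 1 else 1)"

lemma sum_Pow_insert:
  fixes f :: "'a set \<Rightarrow> 'b :: comm_monoid_add"
  assumes "finite S" "i \<notin> S"
  shows "(\<Sum>P\<in>Pow (insert i S). f P) = (\<Sum>P\<in>Pow S. f P) + (\<Sum>P\<in>Pow S. f (insert i P))"
proof -
  have "inj_on (insert i) (Pow S)"
    using assms(2) by (intro inj_onI) (metis PowD insert_ident subsetD)
  moreover have "Pow S \<inter> insert i ` Pow S = {}"
    using assms(2) by auto
  ultimately show ?thesis
    using assms(1) by (simp add: Pow_insert sum.union_disjoint sum.reindex)
qed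

text \<open>Each \<open>A i\<close> enters through eigenvalues \<open>l i\<close> and eigenvectors
  \<open>v i\<close>; \<open>dom\<close> is the hypothesis on the absolute values, expressed by
  these data as an inequality of quadratic forms.\<close>

locale barrier_walk =
  fixes n m :: nat and \<epsilon> :: real and A :: "nat \<Rightarrow> real mat"
    and l :: "nat \<Rightarrow> nat \<Rightarrow> real" and v :: "nat \<Rightarrow> nat \<Rightarrow> real vec"
  assumes n: "0 < n" and m: "0 < m" and \<epsilon>: "0 < \<epsilon>" "\<epsilon> < 1" and m_eq: "real m * \<epsilon>\<^sup>2 = real n"
    and A: "\<And>i. i < m \<Longrightarrow> A i \<in> carrier_mat n n" "\<And>i. i < m \<Longrightarrow> transpose_mat (A i) = A i"
    and v: "\<And>i j. i < m \<Longrightarrow> j < n \<Longrightarrow> v i j \<in> carrier_vec n"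
    and A_eq: "\<And>i. i < m \<Longrightarrow> A i = msum n n (\<lambda>j. l i j \<cdot>\<^sub>m outer (v i j))"
    and dom: "\<And>x. x \<in> carrier_vec n \<Longrightarrow> (\<Sum>i<m. \<Sum>j<n. \<bar>l i j\<bar> * (v i j \<bullet> x)\<^sup>2) \<le> x \<bullet> x"
begin

text \<open>The trace of \<open>|A i| M\<close>.\<close>

definition \<alpha> :: "real mat \<Rightarrow> nat \<Rightarrow> real" where
  "\<alpha> M i = (\<Sum>j<n. \<bar>l i j\<bar> * (v i j \<bullet> (M *\<^sub>v v i j)))"

text \<open>For symmetric \<open>M\<close>, the trace of \<open>|A i| M^2\<close>.\<close>

definition \<beta> :: "real mat \<Rightarrow> nat \<Rightarrow> real" where
  "\<beta> M i = (\<Sum>j<n. \<bar>l i j\<bar> * ((M *\<^sub>v v i j) \<bullet> (M *\<^sub>v v i j)))"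

definition X :: "(nat \<Rightarrow> real) \<Rightarrow> real mat" where
  "X x = msum n m (\<lambda>i. x i \<cdot>\<^sub>m A i)"

text \<open>The two constants are tuned so that, while both traces are at most \<open>8 \<epsilon> m\<close>, raising the barriers by
  \<open>shift\<close> pays for the second-order term caused by a move of size \<open>step\<close>, and \<open>m\<close> shifts stay below
  \<open>\<epsilon> / 2\<close>.\<close>

definition step :: real where "step = 1 / 256"

definition shift :: real where "shift = \<epsilon> / (32 * real m)"

lemma \<alpha>_nonneg: "pos_def_inverse n Z M \<Longrightarrow> i < m \<Longrightarrow> 0 \<le> \<alpha> M i"
  unfolding \<alpha>_def by (intro sum_nonneg mult_nonneg_nonneg pdi_inverse_nonneg[of n Z M]) (simp_all add: v)

lemma \<beta>_nonneg: "0 \<le> \<beta> M i"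
  unfolding \<beta>_def by (intro sum_nonneg mult_nonneg_nonneg scalar_prod_self_ge_0) auto

text \<open>Diagonalizing \<open>M\<close> turns the left side into the form of the sum of all
  \<open>|A i|\<close> at the eigenvectors of \<open>M\<close>, weighted by the eigenvalues. These
  are nonnegative, so \<open>dom\<close> applies termwise.\<close>

lemma sum_\<alpha>_le:
  assumes ZM: "pos_def_inverse n Z M"
  shows "(\<Sum>i<m. \<alpha> M i) \<le> tr n M"
proof -
  obtain \<mu> w where w: "orthonormal n n w" and M: "M = msum n n (\<lambda>k. \<mu> k \<cdot>\<^sub>m outer (w k))"
    using symmetric_mat_spectral[OF pdi_carrier(2)[OF ZM] pdi_symmetric[OF ZM]] by metis
  have wc: "w k \<in> carrier_vec n" if "k < n" for k using w that by (simp add: orthonormal_def)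
  have form: "x \<bullet> (M *\<^sub>v x) = (\<Sum>k<n. \<mu> k * (w k \<bullet> x)\<^sup>2)" if "x \<in> carrier_vec n" for x
    unfolding M using wc that by (subst msum_outer_form) (auto simp: power2_eq_square mult.assoc)
  have \<mu>: "\<mu> k \<ge> 0" if "k < n" for k
  proof -
    have "w k \<bullet> (M *\<^sub>v w k) = (\<Sum>i<n. if i = k then \<mu> k else 0)"
      unfolding form[OF wc[OF that]] using w that by (intro sum.cong) (auto simp: orthonormal_def)
    then show ?thesis using pdi_inverse_nonneg[OF ZM wc[OF that]] that by simp
  qed
  have "(\<Sum>i<m. \<alpha> M i) = (\<Sum>i<m. \<Sum>j<n. \<Sum>k<n. \<mu> k * (\<bar>l i j\<bar> * (v i j \<bullet> w k)\<^sup>2))"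
    unfolding \<alpha>_def using v wc comm_scalar_prod[OF v wc]
    by (intro sum.cong refl) (auto simp: form sum_distrib_left mult_ac)
  also have "\<dots> = (\<Sum>i<m. \<Sum>k<n. \<Sum>j<n. \<mu> k * (\<bar>l i j\<bar> * (v i j \<bullet> w k)\<^sup>2))"
    by (rule sum.cong[OF refl]) (rule sum.swap)
  also have "\<dots> = (\<Sum>k<n. \<Sum>i<m. \<Sum>j<n. \<mu> k * (\<bar>l i j\<bar> * (v i j \<bullet> w k)\<^sup>2))"
    by (rule sum.swap)
  also have "\<dots> = (\<Sum>k<n. \<mu> k * (\<Sum>i<m. \<Sum>j<n. \<bar>l i j\<bar> * (v i j \<bullet> w k)\<^sup>2))"
    by (simp add: sum_distrib_left)
  also have "\<dots> \<le> (\<Sum>k<n. \<mu> k * (w k \<bullet> w k))"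
    using \<mu> wc dom by (intro sum_mono mult_left_mono) auto
  also have "\<dots> = (\<Sum>k<n. \<Sum>a<n. \<mu> k * (w k \<bullet> unit_vec n a)\<^sup>2)"
    using wc by (intro sum.cong refl) (simp only: scalar_prod_eq_sum_sq[of _ n] sum_distrib_left lessThan_iff)
  also have "\<dots> = (\<Sum>a<n. \<Sum>k<n. \<mu> k * (w k \<bullet> unit_vec n a)\<^sup>2)"
    by (rule sum.swap)
  also have "\<dots> = tr n M" unfolding tr_def by (simp add: form)
  finally show ?thesis .
qed

text \<open>Here \<open>dom\<close> is applied at the columns of \<open>M\<close>, whose squared
  norms add up to \<open>tr_square n M\<close>.\<close>

lemma sum_\<beta>_le:
  assumes ZM: "pos_def_inverse n Z M"
  shows "(\<Sum>i<m. \<beta> M i) \<le> tr_square n M"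
proof -
  have c: "M *\<^sub>v unit_vec n a \<in> carrier_vec n" for a using pdi_carrier_vec[OF ZM] by simp
  have "(\<Sum>i<m. \<beta> M i) = (\<Sum>i<m. \<Sum>j<n. \<Sum>a<n. \<bar>l i j\<bar> * (v i j \<bullet> (M *\<^sub>v unit_vec n a))\<^sup>2)"
    unfolding \<beta>_def using v by (intro sum.cong refl) (simp add: norm_inverse_image_eq[OF ZM] sum_distrib_left)
  also have "\<dots> = (\<Sum>i<m. \<Sum>a<n. \<Sum>j<n. \<bar>l i j\<bar> * (v i j \<bullet> (M *\<^sub>v unit_vec n a))\<^sup>2)"
    by (rule sum.cong[OF refl]) (rule sum.swap)
  also have "\<dots> = (\<Sum>a<n. \<Sum>i<m. \<Sum>j<n. \<bar>l i j\<bar> * (v i j \<bullet> (M *\<^sub>v unit_vec n a))\<^sup>2)"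
    by (rule sum.swap)
  also have "\<dots> \<le> tr_square n M"
    unfolding tr_square_def using c by (intro sum_mono dom) auto
  finally show ?thesis .
qed

text \<open>Markov's inequality for the sum of the four normalized quantities.\<close>

lemma exists_good_index:
  assumes ZM: "pos_def_inverse n Z M" and WN: "pos_def_inverse n W N"
    and S: "S \<subseteq> {..<m}" "m \<le> 2 * card S"
  shows "\<exists>i\<in>S. \<alpha> M i \<le> 8 * tr n M / m \<and> \<beta> M i \<le> 8 * tr_square n M / m \<and>
    \<alpha> N i \<le> 8 * tr n N / m \<and> \<beta> N i \<le> 8 * tr_square n N / m"
proof -
  note pos = tr_pos[OF ZM n] tr_pos[OF WN n]
  define f where "f i = \<alpha> M i / tr n M + \<beta> M i / tr_square n M + \<alpha> N i / tr n N + \<beta> N i / tr_square n N" for i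
  have nn: "0 \<le> \<alpha> M i / tr n M" "0 \<le> \<beta> M i / tr_square n M" "0 \<le> \<alpha> N i / tr n N" "0 \<le> \<beta> N i / tr_square n N"
    if "i < m" for i
    using pos \<alpha>_nonneg[OF ZM that] \<alpha>_nonneg[OF WN that] \<beta>_nonneg by (auto intro!: divide_nonneg_pos)
  \<comment> \<open>Each of the four normalized sums over all indices is at most 1 and
    \<open>S\<close> has at least \<open>m / 2\<close> elements, so the mean of \<open>f\<close>
    over \<open>S\<close> is at most \<open>4 / (m / 2)\<close>.\<close>
  have "\<exists>i\<in>S. f i \<le> 8 / m"
  proof (rule ccontr)
    assume "\<not> (\<exists>i\<in>S. f i \<le> 8 / m)"
    then have gt: "f i > 8 / m" if "i \<in> S" for i using that by force
    have "S \<noteq> {}" "finite S" using S m finite_subset by auto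
    then have "(\<Sum>i\<in>S. 8 / real m) < (\<Sum>i\<in>S. f i)"
      using gt by (intro sum_strict_mono) auto
    also have "\<dots> \<le> (\<Sum>i<m. f i)"
    proof (rule sum_mono2)
      fix i assume "i \<in> {..<m} - S"
      then have "i < m" by simp
      then show "0 \<le> f i" unfolding f_def using nn[of i] by linarith
    qed (use S in auto)
    also have "\<dots> = (\<Sum>i<m. \<alpha> M i) / tr n M + (\<Sum>i<m. \<beta> M i) / tr_square n M
        + (\<Sum>i<m. \<alpha> N i) / tr n N + (\<Sum>i<m. \<beta> N i) / tr_square n N"
      by (simp add: f_def sum.distrib sum_divide_distrib)
    also have "\<dots> \<le> 1 + 1 + 1 + 1"
      using pos sum_\<alpha>_le[OF ZM] sum_\<alpha>_le[OF WN] sum_\<beta>_le[OF ZM] sum_\<beta>_le[OF WN]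
      by (intro add_mono) auto
    finally have "real (card S) * 8 < 4 * real m" using m by (simp add: field_simps)
    then show False using S(2) by linarith
  qed
  then obtain i where i: "i \<in> S" "f i \<le> 8 / m" by blast
  have "i < m" using i S by auto
  from nn[OF this] i(2) have "\<alpha> M i / tr n M \<le> 8 / m" "\<beta> M i / tr_square n M \<le> 8 / m"
    "\<alpha> N i / tr n N \<le> 8 / m" "\<beta> N i / tr_square n N \<le> 8 / m"
    unfolding f_def by linarith+
  then show ?thesis using i(1) pos by (intro bexI[of _ i]) (auto simp: pos_divide_le_eq)
qed

text \<open>Adding the bounds for the two signs removes the linear term. Of the gain
  \<open>shift * tr_square n M\<close>, one half pays for the second-order effect of the move and
  the other half for that of the shift itself.\<close>

lemma barrier_step:
  assumes ZM: "pos_def_inverse n Z M" and i: "i < m" and tr: "tr n M \<le> 8 * \<epsilon> * m"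
    and \<alpha>: "\<alpha> M i \<le> 8 * tr n M / m" and \<beta>: "\<beta> M i \<le> 8 * tr_square n M / m"
  shows "\<exists>M' M''. pos_def_inverse n (Z - (step \<cdot>\<^sub>m A i - shift \<cdot>\<^sub>m 1\<^sub>m n)) M' \<and>
    pos_def_inverse n (Z - ((- step) \<cdot>\<^sub>m A i - shift \<cdot>\<^sub>m 1\<^sub>m n)) M'' \<and> tr n M' + tr n M'' \<le> 2 * tr n M"
proof -
  define a where "a = \<alpha> M i"
  define b where "b = \<beta> M i"
  define T where "T = tr n M"
  define \<tau> where "\<tau> = tr_square n M"
  have pos: "T > 0" "\<tau> > 0" "real m > 0" unfolding T_def \<tau>_def using tr_pos[OF ZM n] m by auto
  have a: "0 \<le> a" "a \<le> 8 * T / m" and b: "0 \<le> b" "b \<le> 8 * \<tau> / m"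
    unfolding a_def b_def T_def \<tau>_def using \<alpha> \<beta> \<alpha>_nonneg[OF ZM i] \<beta>_nonneg by auto
  have T: "T \<le> 8 * \<epsilon> * m" using tr by (simp add: T_def)
  have shift0: "0 \<le> shift" unfolding shift_def using \<epsilon> by simp
  from pdi_barrier_step[OF ZM v[OF i] A(1)[OF i] A(2)[OF i] A_eq[OF i] shift0, folded \<alpha>_def \<beta>_def]
  obtain \<gamma> where \<gamma>: "\<And>s. \<bar>s\<bar> * a \<le> 1 / 2 \<Longrightarrow> \<exists>M'. pos_def_inverse n (Z - (s \<cdot>\<^sub>m A i - shift \<cdot>\<^sub>m 1\<^sub>m n)) M' \<and>
      tr n M' \<le> T + s * \<gamma> - shift * \<tau> + 2 * s\<^sup>2 * (a * b) + 2 * shift\<^sup>2 * (T * \<tau>)"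
    unfolding a_def b_def T_def \<tau>_def by blast
  have Tm: "T / m \<le> 8 * \<epsilon>" using T pos by (simp add: field_simps)
  have "step * a \<le> step * (8 * (8 * \<epsilon>))"
    using a Tm by (intro mult_left_mono) (auto simp: step_def)
  also have "\<dots> \<le> 1 / 2" using \<epsilon> by (simp add: step_def)
  finally have sa: "\<bar>step\<bar> * a \<le> 1 / 2" "\<bar>- step\<bar> * a \<le> 1 / 2" by (simp_all add: step_def)
  obtain M' M'' where M': "pos_def_inverse n (Z - (step \<cdot>\<^sub>m A i - shift \<cdot>\<^sub>m 1\<^sub>m n)) M'"
      "tr n M' \<le> T + step * \<gamma> - shift * \<tau> + 2 * step\<^sup>2 * (a * b) + 2 * shift\<^sup>2 * (T * \<tau>)"
    and M'': "pos_def_inverse n (Z - ((- step) \<cdot>\<^sub>m A i - shift \<cdot>\<^sub>m 1\<^sub>m n)) M''"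
      "tr n M'' \<le> T + (- step) * \<gamma> - shift * \<tau> + 2 * (- step)\<^sup>2 * (a * b) + 2 * shift\<^sup>2 * (T * \<tau>)"
    using \<gamma>[OF sa(1)] \<gamma>[OF sa(2)] by blast
  have "a * b \<le> (8 * T / m) * (8 * \<tau> / m)"
    using a b pos by (intro mult_mono) auto
  also have "\<dots> = (T / m) * (64 * \<tau> / m)" by simp
  also have "\<dots> \<le> (8 * \<epsilon>) * (64 * \<tau> / m)"
    using Tm pos by (intro mult_right_mono) auto
  finally have "2 * step\<^sup>2 * (a * b) \<le> 2 * step\<^sup>2 * ((8 * \<epsilon>) * (64 * \<tau> / m))"
    by (intro mult_left_mono) auto
  \<comment> \<open>An equality: it fixes \<open>shift\<close> as
    \<open>1024 * step^2 * 2 * \<epsilon> / m\<close>, that is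
    \<open>\<epsilon> / (32 m)\<close>.\<close>
  also have "\<dots> = shift * \<tau> / 2"
    by (simp add: step_def shift_def power2_eq_square)
  finally have 1: "2 * step\<^sup>2 * (a * b) \<le> shift * \<tau> / 2" .
  have "shift * T \<le> shift * (8 * \<epsilon> * m)"
    using T shift0 by (intro mult_left_mono)
  also have "\<dots> = \<epsilon> * \<epsilon> / 4" using pos by (simp add: shift_def)
  also have "\<dots> \<le> 1 / 4" using \<epsilon> mult_le_one[of \<epsilon> \<epsilon>] by simp
  finally have "2 * (shift * \<tau>) * (shift * T) \<le> 2 * (shift * \<tau>) * (1 / 4)"
    using shift0 pos by (intro mult_left_mono) auto
  then have 2: "2 * shift\<^sup>2 * (T * \<tau>) \<le> shift * \<tau> / 2"
    by (simp add: power2_eq_square mult_ac)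
  have "tr n M' + tr n M'' \<le> 2 * tr n M"
    using M'(2) M''(2) 1 2 by (simp add: T_def)
  then show ?thesis using M'(1) M''(1) by blast
qed

section \<open>The two barriers along the walk\<close>

lemma X_carrier[simp]: "X x \<in> carrier_mat n n" "dim_row (X x) = n" "dim_col (X x) = n"
  by (simp_all add: X_def msum_def)

lemma X_update:
  assumes "i < m" "x i = 0"
  shows "X (x(i := s)) = X x + s \<cdot>\<^sub>m A i"
proof (rule eq_matI)
  fix a b assume "a < dim_row (X x + s \<cdot>\<^sub>m A i)" "b < dim_col (X x + s \<cdot>\<^sub>m A i)"
  then have ab: "a < n" "b < n" using A[OF assms(1)] by auto
  have idx: "X y $$ (a, b) = (\<Sum>j<m. y j * A j $$ (a, b))" for y
  proof -
    have "(y j \<cdot>\<^sub>m A j) $$ (a, b) = y j * A j $$ (a, b)" if "j < m" for j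
      using A(1)[OF that] ab by simp
    then show ?thesis using ab by (simp add: X_def msum_def)
  qed
  have "(\<Sum>j<m. (x(i := s)) j * A j $$ (a, b)) = (\<Sum>j<m. x j * A j $$ (a, b) + (if j = i then s * A i $$ (a, b) else 0))"
    using assms(2) by (intro sum.cong) auto
  also have "\<dots> = (\<Sum>j<m. x j * A j $$ (a, b)) + s * A i $$ (a, b)"
    using assms(1) by (simp add: sum.distrib)
  finally show "X (x(i := s)) $$ (a, b) = (X x + s \<cdot>\<^sub>m A i) $$ (a, b)"
    using ab A(1)[OF assms(1)] by (simp add: idx)
qed (use A[OF assms(1)] in \<open>auto simp: X_def msum_def\<close>)

definition upper :: "real \<Rightarrow> (nat \<Rightarrow> real) \<Rightarrow> real mat" where
  "upper u x = u \<cdot>\<^sub>m 1\<^sub>m n - X x"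

definition lower :: "real \<Rightarrow> (nat \<Rightarrow> real) \<Rightarrow> real mat" where
  "lower u x = u \<cdot>\<^sub>m 1\<^sub>m n + X x"

lemma upper_update:
  assumes "i < m" "x i = 0"
  shows "upper (u + d) (x(i := s)) = upper u x - (s \<cdot>\<^sub>m A i - d \<cdot>\<^sub>m 1\<^sub>m n)"
  unfolding upper_def X_update[of i x, OF assms] using A(1)[OF assms(1)] by (intro eq_matI) simp_all

text \<open>The lower barrier sees every move with the opposite sign, so one perturbation lemma
  serves both barriers.\<close>

lemma lower_update:
  assumes "i < m" "x i = 0"
  shows "lower (u + d) (x(i := s)) = lower u x - ((- s) \<cdot>\<^sub>m A i - d \<cdot>\<^sub>m 1\<^sub>m n)"
  unfolding lower_def X_update[of i x, OF assms] using A(1)[OF assms(1)] by (intro eq_matI) simp_all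

text \<open>For symmetric \<open>X x\<close> this is the operator norm bound in the form in which
  the barriers deliver it; \<open>op_norm_le\<close> translates it at the end.\<close>

definition bounded_by :: "real \<Rightarrow> (nat \<Rightarrow> real) \<Rightarrow> bool" where
  "bounded_by u x \<longleftrightarrow> (\<forall>w \<in> carrier_vec n. \<bar>w \<bullet> (X x *\<^sub>v w)\<bar> \<le> u * (w \<bullet> w))"

lemma bounded_by_mono:
  assumes "bounded_by u x" "u \<le> u'"
  shows "bounded_by u' x"
  unfolding bounded_by_def
proof
  fix w :: "real vec" assume "w \<in> carrier_vec n"
  then have "\<bar>w \<bullet> (X x *\<^sub>v w)\<bar> \<le> u * (w \<bullet> w)"
    using assms(1) by (simp add: bounded_by_def)
  also have "\<dots> \<le> u' * (w \<bullet> w)"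
    using assms(2) scalar_prod_self_ge_0 by (rule mult_right_mono)
  finally show "\<bar>w \<bullet> (X x *\<^sub>v w)\<bar> \<le> u' * (w \<bullet> w)" .
qed

lemma bounded_by_barriers:
  assumes "pos_def_inverse n (upper u x) M" "pos_def_inverse n (lower u x) N"
  shows "bounded_by u x"
  unfolding bounded_by_def
proof
  fix w :: "real vec" assume w: "w \<in> carrier_vec n"
  have c: "X x *\<^sub>v w \<in> carrier_vec n" "u \<cdot>\<^sub>m 1\<^sub>m n *\<^sub>v w = u \<cdot>\<^sub>v w"
    using w mult_mat_vec_carrier[OF X_carrier(1) w] by (auto simp: smult_mat_mult_vec[of _ n n])
  have "upper u x *\<^sub>v w = u \<cdot>\<^sub>v w - X x *\<^sub>v w" "lower u x *\<^sub>v w = u \<cdot>\<^sub>v w + X x *\<^sub>v w"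
    unfolding upper_def lower_def using w c
    by (simp_all add: minus_mult_distrib_mat_vec[of _ n n] add_mult_distrib_mat_vec[of _ n n])
  then have "w \<bullet> (upper u x *\<^sub>v w) = u * (w \<bullet> w) - w \<bullet> (X x *\<^sub>v w)"
    "w \<bullet> (lower u x *\<^sub>v w) = u * (w \<bullet> w) + w \<bullet> (X x *\<^sub>v w)"
    using w c by (simp_all add: scalar_prod_minus_distrib[of _ n] scalar_prod_add_distrib[of _ n])
  then show "\<bar>w \<bullet> (X x *\<^sub>v w)\<bar> \<le> u * (w \<bullet> w)"
    using pdi_nonneg[OF assms(1) w] pdi_nonneg[OF assms(2) w] by linarith
qed

text \<open>The index revealed next may depend on the signs seen so far. The potential \<open>tr M + tr N\<close> is a
  supermartingale, and the walk stops once it exceeds \<open>8 \<epsilon> m\<close>; the factor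
  \<open>1 - (tr M + tr N) / (8 \<epsilon> m)\<close> turns this stopping argument into an induction.\<close>

lemma walk:
  assumes "S \<subseteq> {..<m}" "m + 2 * k \<le> 2 * card S + 2" "\<And>i. i \<in> S \<Longrightarrow> x i = 0"
    and "pos_def_inverse n (upper u x) M" "pos_def_inverse n (lower u x) N"
  shows "\<exists>y. (\<forall>P\<in>Pow S. (\<forall>j. j \<notin> S \<longrightarrow> y P j = x j) \<and> (\<forall>j\<in>S. 0 \<le> sgn_of P j * y P j) \<and>
      bounded_by (u + k * shift) (y P)) \<and>
    2 ^ card S * (step * k * (1 - (tr n M + tr n N) / (8 * \<epsilon> * m))) \<le> (\<Sum>P\<in>Pow S. \<Sum>j\<in>S. sgn_of P j * y P j)"
  using assms
proof (induction k arbitrary: S x u M N)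
  case 0
  then show ?case
    using bounded_by_barriers[OF 0(4,5)] by (intro exI[of _ "\<lambda>_. x"]) auto
next
  case (Suc k)
  note ZM = Suc.prems(4) and WN = Suc.prems(5)
  let ?D = "8 * \<epsilon> * real m"
  have D: "?D > 0" using \<epsilon> m by simp
  have shift0: "shift \<ge> 0" using \<epsilon> by (simp add: shift_def)
  have step0: "step > 0" by (simp add: step_def)
  have trs: "tr n M > 0" "tr n N > 0" using tr_pos[OF ZM n] tr_pos[OF WN n] by auto
  show ?case
  proof (cases "tr n M + tr n N \<le> ?D")
    case False
    \<comment> \<open>The walk stops: the required lower bound is not positive, and staying at
      \<open>x\<close> yields the sum 0 because \<open>x\<close> vanishes on
      \<open>S\<close>.\<close>
    then have "1 - (tr n M + tr n N) / ?D \<le> 0" using D by simp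
    then have "2 ^ card S * (step * Suc k * (1 - (tr n M + tr n N) / ?D)) \<le> 0"
      using step0 by (intro mult_nonneg_nonpos) auto
    moreover have "bounded_by (u + Suc k * shift) x"
      using shift0 by (intro bounded_by_mono[OF bounded_by_barriers[OF ZM WN]]) auto
    ultimately show ?thesis
      using Suc.prems(3) by (intro exI[of _ "\<lambda>_. x"]) auto
  next
    case True
    have "m \<le> 2 * card S" using Suc.prems(2) by simp
    from exists_good_index[OF ZM WN Suc.prems(1) this] obtain i where i: "i \<in> S"
      and good: "\<alpha> M i \<le> 8 * tr n M / m" "\<beta> M i \<le> 8 * tr_square n M / m"
        "\<alpha> N i \<le> 8 * tr n N / m" "\<beta> N i \<le> 8 * tr_square n N / m" by blast
    have im: "i < m" and xi: "x i = 0" using i Suc.prems(1,3) by auto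
    have finS: "finite S" using Suc.prems(1) finite_subset by auto
    define S' where "S' = S - {i}"
    have S': "S = insert i S'" "i \<notin> S'" "finite S'" "S' \<subseteq> {..<m}"
      using i finS Suc.prems(1) by (auto simp: S'_def)
    have cardS: "card S = Suc (card S')" using S' by simp
    obtain M1 M2 where M1: "pos_def_inverse n (upper (u + shift) (x(i := step))) M1"
      and M2: "pos_def_inverse n (upper (u + shift) (x(i := - step))) M2" and trM: "tr n M1 + tr n M2 \<le> 2 * tr n M"
      unfolding upper_update[of i x u shift, OF im xi]
      using barrier_step[OF ZM im _ good(1,2)] True trs by auto
    \<comment> \<open>The order is swapped because the lower barrier sees the move by
      \<open>- step\<close> as a move by \<open>step\<close>.\<close>
    obtain N2 N1 where N1: "pos_def_inverse n (lower (u + shift) (x(i := step))) N1"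
      and N2: "pos_def_inverse n (lower (u + shift) (x(i := - step))) N2" and trN: "tr n N1 + tr n N2 \<le> 2 * tr n N"
      unfolding lower_update[of i x u shift, OF im xi]
      using barrier_step[OF WN im _ good(3,4)] True trs by fastforce
    \<comment> \<open>The claim for the remaining indices \<open>S'\<close> and \<open>k\<close>
      moves, abstracted over what differs between the branches: the starting point and its
      potential.\<close>
    define Q where "Q x' \<Phi> y \<longleftrightarrow> (\<forall>P\<in>Pow S'. (\<forall>j. j \<notin> S' \<longrightarrow> y P j = x' j) \<and> (\<forall>j\<in>S'. 0 \<le> sgn_of P j * y P j) \<and>
        bounded_by (u + shift + k * shift) (y P)) \<and>
      2 ^ card S' * (step * k * (1 - \<Phi> / ?D)) \<le> (\<Sum>P\<in>Pow S'. \<Sum>j\<in>S'. sgn_of P j * y P j)"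
      for x' :: "nat \<Rightarrow> real" and \<Phi> and y :: "nat set \<Rightarrow> nat \<Rightarrow> real"
    have IH: "\<exists>y. Q (x(i := s)) (tr n M' + tr n N') y"
      if "pos_def_inverse n (upper (u + shift) (x(i := s))) M'" "pos_def_inverse n (lower (u + shift) (x(i := s))) N'"
      for s M' N'
      unfolding Q_def using Suc.prems(2,3) S' cardS that by (intro Suc.IH[OF S'(4) _ _ that]) auto
    obtain y1 y2 where y1: "Q (x(i := step)) (tr n M1 + tr n N1) y1"
      and y2: "Q (x(i := - step)) (tr n M2 + tr n N2) y2"
      using IH[OF M1 N1] IH[OF M2 N2] by blast
    \<comment> \<open>A pattern containing \<open>i\<close> is negative there and continues the
      branch that moved by \<open>- step\<close>. The branches know only patterns of
      \<open>S'\<close>, hence the removal of \<open>i\<close>.\<close>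
    define y where "y P = (if i \<in> P then y2 (P - {i}) else y1 P)" for P
    have sg: "sgn_of (P - {i}) j = sgn_of P j" "sgn_of (insert i P) j = sgn_of P j" if "j \<noteq> i" for P j
      using that by (auto simp: sgn_of_def)
    have eq: "u + Suc k * shift = u + shift + k * shift" by (simp add: algebra_simps)
    have 1: "(\<forall>j. j \<notin> S \<longrightarrow> y P j = x j) \<and> (\<forall>j\<in>S. 0 \<le> sgn_of P j * y P j) \<and> bounded_by (u + Suc k * shift) (y P)"
      if P: "P \<in> Pow S" for P
    proof (cases "i \<in> P")
      case True
      have P': "P - {i} \<in> Pow S'" using P by (auto simp: S'_def)
      have "sgn_of P j = sgn_of (P - {i}) j" if "j \<in> S'" for j
        using that S' sg by metis
      moreover have "sgn_of P i = - 1" using True by (simp add: sgn_of_def)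
      moreover have "(\<forall>j. j \<notin> S' \<longrightarrow> y2 (P - {i}) j = (x(i := - step)) j) \<and>
        (\<forall>j\<in>S'. 0 \<le> sgn_of (P - {i}) j * y2 (P - {i}) j) \<and> bounded_by (u + Suc k * shift) (y2 (P - {i}))"
        unfolding eq using y2 P' unfolding Q_def by blast
      ultimately show ?thesis
        using True S' step0 unfolding y_def by auto
    next
      case False
      have P': "P \<in> Pow S'" using P False by (auto simp: S'_def)
      have "sgn_of P i = 1" using False by (simp add: sgn_of_def)
      moreover have "(\<forall>j. j \<notin> S' \<longrightarrow> y1 P j = (x(i := step)) j) \<and>
        (\<forall>j\<in>S'. 0 \<le> sgn_of P j * y1 P j) \<and> bounded_by (u + Suc k * shift) (y1 P)"
        unfolding eq using y1 P' unfolding Q_def by blast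
      ultimately show ?thesis
        using False S' step0 unfolding y_def by auto
    qed
    have e1: "(\<Sum>j\<in>S. sgn_of P j * y P j) = step + (\<Sum>j\<in>S'. sgn_of P j * y1 P j)" if P: "P \<in> Pow S'" for P
    proof -
      have "i \<notin> P" using P S' by auto
      then show ?thesis
        using y1 P S' by (simp add: Q_def y_def sgn_of_def)
    qed
    have e2: "(\<Sum>j\<in>S. sgn_of (insert i P) j * y (insert i P) j) = step + (\<Sum>j\<in>S'. sgn_of P j * y2 P j)"
      if P: "P \<in> Pow S'" for P
    proof -
      have iP: "i \<notin> P" using P S' by auto
      then have y: "y (insert i P) = y2 P" by (simp add: y_def)
      have "(\<Sum>j\<in>S'. sgn_of (insert i P) j * y2 P j) = (\<Sum>j\<in>S'. sgn_of P j * y2 P j)"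
        using S' sg by (intro sum.cong refl) (metis)
      moreover have "y2 P i = - step" using y2 P S' by (simp add: Q_def)
      moreover have "sgn_of (insert i P) i = - 1" by (simp add: sgn_of_def)
      ultimately show ?thesis
        unfolding S'(1) y using S'(2,3) by simp
    qed
    let ?c = "2 ^ card S' :: real"
    have cS: "2 ^ card S = 2 * ?c" by (simp add: cardS)
    have "(\<Sum>P\<in>Pow S. \<Sum>j\<in>S. sgn_of P j * y P j) =
        (\<Sum>P\<in>Pow S'. \<Sum>j\<in>S. sgn_of P j * y P j) + (\<Sum>P\<in>Pow S'. \<Sum>j\<in>S. sgn_of (insert i P) j * y (insert i P) j)"
      unfolding S'(1) using S'(2,3) by (intro sum_Pow_insert)
    also have "\<dots> = (\<Sum>P\<in>Pow S'. step + (\<Sum>j\<in>S'. sgn_of P j * y1 P j)) +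
        (\<Sum>P\<in>Pow S'. step + (\<Sum>j\<in>S'. sgn_of P j * y2 P j))"
      using e1 e2 by simp
    also have "\<dots> = 2 * ?c * step + ((\<Sum>P\<in>Pow S'. \<Sum>j\<in>S'. sgn_of P j * y1 P j) + (\<Sum>P\<in>Pow S'. \<Sum>j\<in>S'. sgn_of P j * y2 P j))"
      using S'(3) by (simp add: sum.distrib card_Pow)
    also have "\<dots> \<ge> 2 * ?c * step + (?c * (step * k * (1 - (tr n M1 + tr n N1) / ?D)) + ?c * (step * k * (1 - (tr n M2 + tr n N2) / ?D)))"
      using y1 y2 unfolding Q_def by (intro add_mono) auto
    finally have ge: "2 * ?c * step + (?c * (step * k * (1 - (tr n M1 + tr n N1) / ?D)) + ?c * (step * k * (1 - (tr n M2 + tr n N2) / ?D)))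
      \<le> (\<Sum>P\<in>Pow S. \<Sum>j\<in>S. sgn_of P j * y P j)" .
    define q where "q = (tr n M + tr n N) / ?D"
    define q1 where "q1 = (tr n M1 + tr n N1) / ?D"
    define q2 where "q2 = (tr n M2 + tr n N2) / ?D"
    have "q1 + q2 \<le> 2 * q"
    proof -
      have "q1 + q2 = (tr n M1 + tr n N1 + (tr n M2 + tr n N2)) / ?D"
        unfolding q1_def q2_def by (rule add_divide_distrib[symmetric])
      also have "\<dots> \<le> (2 * (tr n M + tr n N)) / ?D"
        using trM trN D by (intro divide_right_mono) auto
      finally show ?thesis by (simp add: q_def)
    qed
    then have "?c * (step * k) * (2 - 2 * q) \<le> ?c * (step * k) * (2 - (q1 + q2))"
      using step0 by (intro mult_left_mono) auto
    \<comment> \<open>The present move gains a full \<open>step\<close>, which is at least the share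
      \<open>step * (1 - q)\<close> that the claim for \<open>Suc k\<close> demands of it.\<close>
    moreover have "0 \<le> ?c * step * q"
      using trs D step0 unfolding q_def by simp
    ultimately have "2 * ?c * (step * Suc k * (1 - q)) \<le>
        2 * ?c * step + (?c * (step * k * (1 - q1)) + ?c * (step * k * (1 - q2)))"
      by (simp add: algebra_simps)
    then have "2 ^ card S * (step * Suc k * (1 - (tr n M + tr n N) / ?D)) \<le> (\<Sum>P\<in>Pow S. \<Sum>j\<in>S. sgn_of P j * y P j)"
      using ge unfolding cS q_def q1_def q2_def by linarith
    then show ?thesis using 1 by blast
  qed
qed

text \<open>Starting at \<open>\<epsilon> / 2\<close>, the two traces add up to
  \<open>4 \<epsilon> m\<close>, half of the stopping threshold, so the factor in
  \<open>walk\<close> is \<open>1 / 2\<close>. With \<open>m div 2\<close> moves, at least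
  \<open>m / 3\<close> as \<open>2 \<le> m\<close>, the average is at least
  \<open>1 / 256 * (m / 3) * (1 / 2)\<close>.\<close>

lemma walk_from_origin:
  assumes "2 \<le> m"
  shows "\<exists>y. (\<forall>P\<in>Pow {..<m}. (\<forall>j<m. 0 \<le> sgn_of P j * y P j) \<and> bounded_by \<epsilon> (y P)) \<and>
    2 ^ m * (real m / 1536) \<le> (\<Sum>P\<in>Pow {..<m}. \<Sum>j<m. sgn_of P j * y P j)"
proof -
  define M where "M = (2 / \<epsilon>) \<cdot>\<^sub>m (1\<^sub>m n :: real mat)"
  have X0: "X (\<lambda>_. 0) = 0\<^sub>m n n"
  proof (rule eq_matI)
    fix a b assume ab: "a < dim_row (0\<^sub>m n n :: real mat)" "b < dim_col (0\<^sub>m n n :: real mat)"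
    have "(0 \<cdot>\<^sub>m A i) $$ (a, b) = 0" if "i < m" for i using A(1)[OF that] ab by simp
    then show "X (\<lambda>_. 0) $$ (a, b) = 0\<^sub>m n n $$ (a, b)" using ab by (simp add: X_def msum_def)
  qed (auto simp: X_def msum_def)
  have id: "(\<epsilon> / 2) \<cdot>\<^sub>m (1\<^sub>m n :: real mat) - 0\<^sub>m n n = (\<epsilon> / 2) \<cdot>\<^sub>m 1\<^sub>m n"
    "(\<epsilon> / 2) \<cdot>\<^sub>m (1\<^sub>m n :: real mat) + 0\<^sub>m n n = (\<epsilon> / 2) \<cdot>\<^sub>m 1\<^sub>m n"
    by (intro eq_matI; simp)+
  have "pos_def n ((\<epsilon> / 2) \<cdot>\<^sub>m 1\<^sub>m n)"
    unfolding pos_def_def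
  proof (intro conjI ballI impI)
    show "transpose_mat ((\<epsilon> / 2) \<cdot>\<^sub>m 1\<^sub>m n :: real mat) = (\<epsilon> / 2) \<cdot>\<^sub>m 1\<^sub>m n"
      by (intro eq_matI) auto
    fix w :: "real vec" assume w: "w \<in> carrier_vec n" "w \<noteq> 0\<^sub>v n"
    then have "w \<bullet> w > 0"
      using scalar_prod_self_eq_0_iff[OF w(1)] scalar_prod_self_ge_0[of w] by linarith
    then show "0 < w \<bullet> ((\<epsilon> / 2) \<cdot>\<^sub>m 1\<^sub>m n *\<^sub>v w)"
      using w \<epsilon> by (simp add: smult_mat_mult_vec[of _ n n])
  qed auto
  moreover have "(\<epsilon> / 2) \<cdot>\<^sub>m 1\<^sub>m n * M = 1\<^sub>m n" "M * ((\<epsilon> / 2) \<cdot>\<^sub>m 1\<^sub>m n) = 1\<^sub>m n"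
    unfolding M_def using \<epsilon> by (intro eq_matI; simp)+
  ultimately have pdi: "pos_def_inverse n ((\<epsilon> / 2) \<cdot>\<^sub>m 1\<^sub>m n) M"
    by (simp add: pos_def_inverse_def M_def)
  have trM: "tr n M = 2 * \<epsilon> * m"
  proof -
    have "tr n M = real n * (2 / \<epsilon>)"
      by (simp add: tr_def M_def smult_mat_mult_vec[of _ n n])
    then show ?thesis
      using m_eq[symmetric] \<epsilon> by (simp add: power2_eq_square)
  qed
  have up: "pos_def_inverse n (upper (\<epsilon> / 2) (\<lambda>_. 0)) M" and low: "pos_def_inverse n (lower (\<epsilon> / 2) (\<lambda>_. 0)) M"
    using pdi unfolding upper_def lower_def X0 id by auto
  have "m + 2 * (m div 2) \<le> 2 * card {..<m} + 2" by simp
  from walk[OF subset_refl this refl up low]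
  obtain y where y: "\<And>P. P \<in> Pow {..<m} \<Longrightarrow> (\<forall>j<m. 0 \<le> sgn_of P j * y P j) \<and> bounded_by (\<epsilon> / 2 + (m div 2) * shift) (y P)"
    "2 ^ m * (step * (m div 2) * (1 - (tr n M + tr n M) / (8 * \<epsilon> * m))) \<le> (\<Sum>P\<in>Pow {..<m}. \<Sum>j<m. sgn_of P j * y P j)"
    unfolding card_lessThan by blast
  have half: "real (m div 2) \<ge> real m / 3"
  proof -
    have "m \<le> 3 * (m div 2)" using assms by presburger
    then show ?thesis by linarith
  qed
  have phi: "1 - (tr n M + tr n M) / (8 * \<epsilon> * m) = 1 / 2"
    unfolding trM using \<epsilon> m by (simp add: field_simps)
  have "real m / 1536 \<le> step * (m div 2) * (1 / 2)"
    using half by (simp add: step_def)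
  then have "2 ^ m * (real m / 1536) \<le> 2 ^ m * (step * (m div 2) * (1 - (tr n M + tr n M) / (8 * \<epsilon> * m)))"
    unfolding phi by (intro mult_left_mono) simp_all
  then have "2 ^ m * (real m / 1536) \<le> (\<Sum>P\<in>Pow {..<m}. \<Sum>j<m. sgn_of P j * y P j)"
    using y(2) by linarith
  moreover have "\<epsilon> / 2 + (m div 2) * shift \<le> \<epsilon>"
  proof -
    have "(m div 2) * shift \<le> real m * shift"
      using \<epsilon> by (intro mult_right_mono) (auto simp: shift_def)
    also have "\<dots> = \<epsilon> / 32" using m by (simp add: shift_def)
    finally show ?thesis using \<epsilon> by simp
  qed
  ultimately show ?thesis
    using y(1) bounded_by_mono by blast
qed

end

section \<open>The operator norm\<close>

lemma msum_form:
  assumes B: "\<And>k. k < p \<Longrightarrow> B k \<in> carrier_mat n n" and x: "x \<in> carrier_vec n" "y \<in> carrier_vec n"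
  shows "x \<bullet> (msum n p B *\<^sub>v y) = (\<Sum>k<p. x \<bullet> (B k *\<^sub>v y))"
proof -
  have "x \<bullet> (msum n p B *\<^sub>v y) = (\<Sum>i<n. \<Sum>j<n. \<Sum>k<p. x $ i * B k $$ (i, j) * y $ j)"
    using x by (simp add: bilinear_form_eq_sum[of _ n])
      (simp add: msum_def sum_distrib_left sum_distrib_right)
  also have "\<dots> = (\<Sum>i<n. \<Sum>k<p. \<Sum>j<n. x $ i * B k $$ (i, j) * y $ j)"
    by (rule sum.cong[OF refl]) (rule sum.swap)
  also have "\<dots> = (\<Sum>k<p. \<Sum>i<n. \<Sum>j<n. x $ i * B k $$ (i, j) * y $ j)"
    by (rule sum.swap)
  also have "\<dots> = (\<Sum>k<p. x \<bullet> (B k *\<^sub>v y))"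
    using B x by (simp add: bilinear_form_eq_sum[of _ n])
  finally show ?thesis .
qed

lemma orthonormal_parseval:
  assumes w: "orthonormal n n w" and x: "x \<in> carrier_vec n"
  shows "x \<bullet> x = (\<Sum>j<n. (w j \<bullet> x)\<^sup>2)"
proof -
  have wc: "w j \<in> carrier_vec n" if "j < n" for j using w that by (simp add: orthonormal_def)
  have "x \<bullet> x = (\<Sum>b<n. x $ b * x $ b)"
    using x by (simp add: scalar_prod_def lessThan_atLeast0)
  also have "\<dots> = (\<Sum>b<n. x $ b * (\<Sum>j<n. (x \<bullet> w j) * w j $ b))"
    by (simp add: orthonormal_expansion[OF w x])
  also have "\<dots> = (\<Sum>b<n. \<Sum>j<n. (x \<bullet> w j) * (x $ b * w j $ b))"
    by (simp add: sum_distrib_left mult_ac)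
  also have "\<dots> = (\<Sum>j<n. \<Sum>b<n. (x \<bullet> w j) * (x $ b * w j $ b))"
    by (rule sum.swap)
  also have "\<dots> = (\<Sum>j<n. (x \<bullet> w j) * (x \<bullet> w j))"
  proof (rule sum.cong[OF refl])
    fix j assume "j \<in> {..<n}"
    then have "x \<bullet> w j = (\<Sum>b<n. x $ b * w j $ b)"
      using wc[of j] by (auto simp: scalar_prod_def lessThan_atLeast0)
    then show "(\<Sum>b<n. (x \<bullet> w j) * (x $ b * w j $ b)) = (x \<bullet> w j) * (x \<bullet> w j)"
      by (simp add: sum_distrib_left)
  qed
  also have "\<dots> = (\<Sum>j<n. (w j \<bullet> x)\<^sup>2)"
    using comm_scalar_prod[OF x wc] by (intro sum.cong refl) (simp add: power2_eq_square)
  finally show ?thesis .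
qed

text \<open>In an eigenbasis of \<open>X\<close> the form of \<open>X^T X\<close> has coefficients
  \<open>(l k)\<^sup>2\<close>, each at most \<open>u\<^sup>2\<close>. As \<open>op_norm\<close> is
  a \<open>Max\<close>, the set of singular values must also be shown finite, by the roots of the
  characteristic polynomial, and nonempty, by the eigenvector \<open>v 0\<close>.\<close>

lemma op_norm_le:
  assumes X: "X \<in> carrier_mat n n" "transpose_mat X = X" and "0 < n"
    and le: "\<And>w. w \<in> carrier_vec n \<Longrightarrow> \<bar>w \<bullet> (X *\<^sub>v w)\<bar> \<le> u * (w \<bullet> w)"
  shows "op_norm X \<le> u"
proof -
  obtain l v where v: "orthonormal n n v" and X_eq: "X = msum n n (\<lambda>k. l k \<cdot>\<^sub>m outer (v k))"
    using symmetric_mat_spectral[OF X] by metis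
  have vc: "v k \<in> carrier_vec n" if "k < n" for k using v that by (simp add: orthonormal_def)
  have XX: "transpose_mat X * X \<in> carrier_mat n n" using X by simp
  have XXw: "(transpose_mat X * X) *\<^sub>v w = X *\<^sub>v (X *\<^sub>v w)" if "w \<in> carrier_vec n" for w
    using X that by (simp add: assoc_mult_mat_vec[of _ n n])
  have vX: "v k \<bullet> (X *\<^sub>v w) = l k * (v k \<bullet> w)" if "k < n" "w \<in> carrier_vec n" for k w
  proof -
    have "v k \<bullet> (X *\<^sub>v w) = (\<Sum>j<n. l j * (v j \<bullet> v k) * (v j \<bullet> w))"
      unfolding X_eq using vc that by (intro msum_outer_form) auto
    also have "\<dots> = (\<Sum>j<n. if j = k then l k * (v k \<bullet> w) else 0)"
      using v that by (intro sum.cong) (auto simp: orthonormal_def)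
    finally show ?thesis using that by simp
  qed
  have lk: "\<bar>l k\<bar> \<le> u" if "k < n" for k
    using le[OF vc[OF that]] vX[OF that vc[OF that]] v that by (simp add: orthonormal_def)
  have ev: "sqrt \<kappa> \<le> u" if \<kappa>: "eigenvalue (transpose_mat X * X) \<kappa>" for \<kappa>
  proof -
    obtain w where w: "w \<in> carrier_vec n" "w \<noteq> 0\<^sub>v n" "(transpose_mat X * X) *\<^sub>v w = \<kappa> \<cdot>\<^sub>v w"
      using \<kappa> unfolding eigenvalue_def eigenvector_def carrier_matD(1)[OF XX] by blast
    have pos: "w \<bullet> w > 0"
      using w scalar_prod_self_eq_0_iff[OF w(1)] scalar_prod_self_ge_0[of w] by linarith
    have Xw: "X *\<^sub>v w \<in> carrier_vec n" using X w by simp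
    have "\<kappa> * (w \<bullet> w) = w \<bullet> (X *\<^sub>v (X *\<^sub>v w))"
      using w(1,3) XXw[OF w(1)] by (metis scalar_prod_smult_distrib)
    also have "\<dots> = (\<Sum>k<n. l k * (v k \<bullet> w) * (v k \<bullet> (X *\<^sub>v w)))"
      by (subst X_eq) (use vc w Xw in \<open>intro msum_outer_form, auto\<close>)
    also have "\<dots> = (\<Sum>k<n. (l k)\<^sup>2 * (v k \<bullet> w)\<^sup>2)"
      using w vX by (intro sum.cong refl) (simp add: power2_eq_square mult_ac)
    also have "\<dots> \<le> (\<Sum>k<n. u\<^sup>2 * (v k \<bullet> w)\<^sup>2)"
    proof (intro sum_mono mult_right_mono)
      fix k assume "k \<in> {..<n}"
      then show "(l k)\<^sup>2 \<le> u\<^sup>2"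
        using lk[of k] power_mono[of "\<bar>l k\<bar>" u 2] by simp
    qed auto
    also have "\<dots> = u\<^sup>2 * (w \<bullet> w)"
      by (simp add: orthonormal_parseval[OF v w(1)] sum_distrib_left)
    finally have "\<kappa> \<le> u\<^sup>2" using pos by simp
    then show ?thesis using lk[OF \<open>0 < n\<close>] by (intro real_le_lsqrt) auto
  qed
  have "finite {\<kappa>. eigenvalue (transpose_mat X * X) \<kappa>}"
    unfolding eigenvalue_root_char_poly[OF XX] using degree_monic_char_poly[OF XX]
    by (intro poly_roots_finite) auto
  then have fin: "finite (singular_values X)"
    by (simp add: singular_values_def setcompr_eq_image)
  have "X *\<^sub>v v 0 = l 0 \<cdot>\<^sub>v v 0"
  proof (rule eq_vecI)
    fix a assume "a < dim_vec (l 0 \<cdot>\<^sub>v v 0)"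
    then have a: "a < n" using vc[OF \<open>0 < n\<close>] by simp
    have "(X *\<^sub>v v 0) $ a = (\<Sum>j<n. ((X *\<^sub>v v 0) \<bullet> v j) * v j $ a)"
      using orthonormal_expansion[OF v _ a] X vc[OF \<open>0 < n\<close>] by simp
    also have "\<dots> = (\<Sum>j<n. if j = 0 then l 0 * v 0 $ a else 0)"
    proof (intro sum.cong refl)
      fix j assume "j \<in> {..<n}"
      then have "(X *\<^sub>v v 0) \<bullet> v j = l j * (v j \<bullet> v 0)"
        using vX[of j "v 0"] X vc \<open>0 < n\<close> comm_scalar_prod[of "X *\<^sub>v v 0" n "v j"] by simp
      then show "((X *\<^sub>v v 0) \<bullet> v j) * v j $ a = (if j = 0 then l 0 * v 0 $ a else 0)"
        using v \<open>j \<in> {..<n}\<close> \<open>0 < n\<close> by (simp add: orthonormal_def)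
    qed
    finally show "(X *\<^sub>v v 0) $ a = (l 0 \<cdot>\<^sub>v v 0) $ a"
      using \<open>0 < n\<close> a vc[OF \<open>0 < n\<close>] by simp
  qed (use X vc[OF \<open>0 < n\<close>] in auto)
  then have "(transpose_mat X * X) *\<^sub>v v 0 = (l 0 * l 0) \<cdot>\<^sub>v v 0"
    using XXw[OF vc[OF \<open>0 < n\<close>]] X vc[OF \<open>0 < n\<close>] by (simp add: mult_mat_vec[of _ n n] smult_smult_assoc)
  moreover have "v 0 \<noteq> 0\<^sub>v n"
  proof
    assume "v 0 = 0\<^sub>v n"
    moreover have "v 0 \<bullet> v 0 = 1" using v \<open>0 < n\<close> by (simp add: orthonormal_def)
    ultimately show False by simp
  qed
  ultimately have "eigenvalue (transpose_mat X * X) (l 0 * l 0)"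
    using X vc[OF \<open>0 < n\<close>] by (auto simp: eigenvalue_def eigenvector_def)
  then have "singular_values X \<noteq> {}" by (auto simp: singular_values_def)
  then show ?thesis
    unfolding op_norm_def using fin ev by (subst Max_le_iff) (auto simp: singular_values_def)
qed

text \<open>Instantiates the walk with one eigendecomposition per matrix and restates its outcome
  for \<open>op_norm\<close>.\<close>

lemma exists_signed_points:
  fixes A :: "nat \<Rightarrow> real mat"
  assumes A: "\<And>i. i < m \<Longrightarrow> A i \<in> carrier_mat n n" "\<And>i. i < m \<Longrightarrow> transpose_mat (A i) = A i"
    and dom: "msum n m (\<lambda>i. mat_abs (A i)) \<preceq>\<^sub>L 1\<^sub>m n"
    and \<epsilon>: "0 < \<epsilon>" "\<epsilon> < 1" and m_eq: "real m = real n / \<epsilon>\<^sup>2" and m2: "2 \<le> m"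
  shows "\<exists>y. (\<forall>P\<in>Pow {..<m}. (\<forall>j<m. 0 \<le> sgn_of P j * y P j) \<and>
      op_norm (msum n m (\<lambda>i. y P i \<cdot>\<^sub>m A i)) \<le> \<epsilon>) \<and>
    2 ^ m * (real m / 1536) \<le> (\<Sum>P\<in>Pow {..<m}. \<Sum>j<m. sgn_of P j * y P j)"
proof -
  define R where "R i lv \<longleftrightarrow> orthonormal n n (snd lv) \<and> A i = msum n n (\<lambda>j. fst lv j \<cdot>\<^sub>m outer (snd lv j)) \<and>
      mat_abs (A i) = msum n n (\<lambda>j. \<bar>fst lv j\<bar> \<cdot>\<^sub>m outer (snd lv j))"
    for i :: nat and lv :: "(nat \<Rightarrow> real) \<times> (nat \<Rightarrow> real vec)"
  have "\<exists>lv. R i lv" if "i < m" for i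
  proof (rule symmetric_mat_spectral[OF A(1)[OF that] A(2)[OF that]])
    fix l v assume "orthonormal n n v" "A i = msum n n (\<lambda>j. l j \<cdot>\<^sub>m outer (v j))"
      "mat_abs (A i) = msum n n (\<lambda>j. \<bar>l j\<bar> \<cdot>\<^sub>m outer (v j))"
    then show ?thesis by (intro exI[of _ "(l, v)"]) (simp add: R_def)
  qed
  then obtain f where f: "R i (f i)" if "i < m" for i by metis
  define l v where "l i = fst (f i)" and "v i = snd (f i)" for i
  have lv: "\<And>i. i < m \<Longrightarrow> orthonormal n n (v i)"
    "\<And>i. i < m \<Longrightarrow> A i = msum n n (\<lambda>j. l i j \<cdot>\<^sub>m outer (v i j))"
    "\<And>i. i < m \<Longrightarrow> mat_abs (A i) = msum n n (\<lambda>j. \<bar>l i j\<bar> \<cdot>\<^sub>m outer (v i j))"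
    using f unfolding R_def l_def v_def by blast+
  have vc: "v i j \<in> carrier_vec n" if "i < m" "j < n" for i j
    using lv(1)[OF that(1)] that by (simp add: orthonormal_def)
  have n: "0 < n" using m2 m_eq by (cases n) auto
  interpret barrier_walk n m \<epsilon> A l v
  proof
    show "real m * \<epsilon>\<^sup>2 = real n" using m_eq \<epsilon> by simp
    fix x :: "real vec" assume x: "x \<in> carrier_vec n"
    let ?S = "msum n m (\<lambda>i. mat_abs (A i))"
    have "0 \<le> x \<bullet> ((1\<^sub>m n - ?S) *\<^sub>v x)"
      using dom x by (simp add: loewner_le_def pos_semidef_def msum_def)
    also have "(1\<^sub>m n - ?S) *\<^sub>v x = x - ?S *\<^sub>v x"
      using x by (subst minus_mult_distrib_mat_vec[of _ n n]) auto
    also have "x \<bullet> (x - ?S *\<^sub>v x) = x \<bullet> x - x \<bullet> (?S *\<^sub>v x)"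
      using x mult_mat_vec_carrier[OF msum_carrier x] by (intro scalar_prod_minus_distrib) auto
    also have "x \<bullet> (?S *\<^sub>v x) = (\<Sum>i<m. x \<bullet> (mat_abs (A i) *\<^sub>v x))"
      using x lv(3) by (intro msum_form) auto
    also have "\<dots> = (\<Sum>i<m. \<Sum>j<n. \<bar>l i j\<bar> * (v i j \<bullet> x)\<^sup>2)"
      using x vc by (intro sum.cong refl) (simp add: lv(3) msum_outer_form power2_eq_square mult.assoc)
    finally show "(\<Sum>i<m. \<Sum>j<n. \<bar>l i j\<bar> * (v i j \<bullet> x)\<^sup>2) \<le> x \<bullet> x" by simp
  qed (use n m2 \<epsilon> A vc lv(2) in auto)
  obtain y where y: "\<And>P. P \<in> Pow {..<m} \<Longrightarrow> (\<forall>j<m. 0 \<le> sgn_of P j * y P j) \<and> bounded_by \<epsilon> (y P)"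
    "2 ^ m * (real m / 1536) \<le> (\<Sum>P\<in>Pow {..<m}. \<Sum>j<m. sgn_of P j * y P j)"
    using walk_from_origin[OF m2] by blast
  have "transpose_mat (X x) = X x" for x
  proof (rule eq_matI)
    fix a b assume "a < dim_row (X x)" "b < dim_col (X x)"
    then have ab: "a < n" "b < n" by (auto simp: X_def msum_def)
    have "A i $$ (b, a) = A i $$ (a, b)" if "i < m" for i
      using A[OF that] ab by (metis carrier_matD index_transpose_mat(1))
    moreover have "(x i \<cdot>\<^sub>m A i) $$ (a, b) = x i * A i $$ (a, b)" "(x i \<cdot>\<^sub>m A i) $$ (b, a) = x i * A i $$ (b, a)"
      if "i < m" for i using A(1)[OF that] ab by auto
    ultimately show "transpose_mat (X x) $$ (a, b) = X x $$ (a, b)"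
      using ab by (auto simp: X_def msum_def intro!: sum.cong)
  qed (auto simp: X_def msum_def)
  then have "op_norm (X (y P)) \<le> \<epsilon>" if "P \<in> Pow {..<m}" for P
    using y(1)[OF that] n by (intro op_norm_le[of _ n]) (auto simp: bounded_by_def)
  then show ?thesis using y unfolding X_def by blast
qed

section \<open>Lebesgue measure of slabs of the Euclidean ball\<close>

abbreviation lborel_pow :: "nat \<Rightarrow> (nat \<Rightarrow> real) measure" where
  "lborel_pow m \<equiv> Pi\<^sub>M {..<m} (\<lambda>_. lborel)"

definition unit_ball :: "nat \<Rightarrow> (nat \<Rightarrow> real) set" where
  "unit_ball m = {a \<in> {..<m} \<rightarrow>\<^sub>E UNIV. eucl_norm m a \<le> 1}"

lemma measurable_affine_map[measurable]:
  "(\<lambda>a. \<lambda>i\<in>{..<m}. d i + c i * a i) \<in> lborel_pow m \<rightarrow>\<^sub>M lborel_pow m"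
  by (rule measurable_restrict) measurable

text \<open>Product measures are determined by boxes, which reduces the claim to the affine rule on
  the line. One statement covers the dilations, translations and sign flips used below.\<close>

lemma lborel_pow_affine:
  fixes c d :: "nat \<Rightarrow> real"
  assumes c: "\<And>i. i < m \<Longrightarrow> c i \<noteq> 0"
  shows "lborel_pow m = density (distr (lborel_pow m) (lborel_pow m) (\<lambda>a. \<lambda>i\<in>{..<m}. d i + c i * a i))
    (\<lambda>_. ennreal (\<Prod>i<m. \<bar>c i\<bar>))"
proof -
  interpret product_sigma_finite "\<lambda>_::nat. lborel :: real measure" by standard
  let ?T = "\<lambda>a. \<lambda>i\<in>{..<m}. d i + c i * a i"
  have "density (distr (lborel_pow m) (lborel_pow m) ?T) (\<lambda>_. ennreal (\<Prod>i<m. \<bar>c i\<bar>)) = lborel_pow m"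
  proof (rule PiM_eqI)
    fix A :: "nat \<Rightarrow> real set" assume A: "\<And>i. i \<in> {..<m} \<Longrightarrow> A i \<in> sets lborel"
    have E: "Pi\<^sub>E {..<m} A \<in> sets (lborel_pow m)"
      using A by (intro sets_PiM_I_finite) auto
    let ?B = "\<lambda>i. (\<lambda>x. d i + c i * x) -` A i"
    have B: "?B i \<in> sets lborel" if "i < m" for i
    proof -
      have "(\<lambda>x. d i + c i * x) \<in> borel \<rightarrow>\<^sub>M borel" by measurable
      from measurable_sets[OF this, of "A i"] show ?thesis using A that by simp
    qed
    have pre: "?T -` Pi\<^sub>E {..<m} A \<inter> space (lborel_pow m) = Pi\<^sub>E {..<m} ?B"
      by (auto simp: space_PiM PiE_iff)
    have one: "ennreal \<bar>c i\<bar> * emeasure lborel (?B i) = emeasure lborel (A i)" if "i < m" for i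
    proof -
      have Ai: "A i \<in> sets borel" using A that by simp
      have "emeasure lborel (A i) = emeasure (density (distr lborel borel (\<lambda>x. d i + c i * x)) (\<lambda>_. ennreal \<bar>c i\<bar>)) (A i)"
        using lborel_real_affine[OF c[OF that], of "d i"] by simp
      also have "\<dots> = ennreal \<bar>c i\<bar> * emeasure lborel (?B i)"
        using Ai by (simp add: emeasure_density_const emeasure_distr)
      finally show ?thesis by simp
    qed
    have "emeasure (density (distr (lborel_pow m) (lborel_pow m) ?T) (\<lambda>_. ennreal (\<Prod>i<m. \<bar>c i\<bar>))) (Pi\<^sub>E {..<m} A)
      = ennreal (\<Prod>i<m. \<bar>c i\<bar>) * emeasure (lborel_pow m) (Pi\<^sub>E {..<m} ?B)"
      using E by (simp add: emeasure_density_const emeasure_distr pre)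
    also have "\<dots> = (\<Prod>i<m. ennreal \<bar>c i\<bar>) * (\<Prod>i<m. emeasure lborel (?B i))"
      using B by (subst emeasure_PiM) (auto simp: prod_ennreal)
    also have "\<dots> = (\<Prod>i<m. emeasure lborel (A i))"
      using one by (simp flip: prod.distrib)
    finally show "emeasure (density (distr (lborel_pow m) (lborel_pow m) ?T) (\<lambda>_. ennreal (\<Prod>i<m. \<bar>c i\<bar>))) (Pi\<^sub>E {..<m} A)
      = (\<Prod>i\<in>{..<m}. emeasure lborel (A i))" .
  qed auto
  then show ?thesis by simp
qed

lemma nn_integral_lborel_pow_affine:
  fixes c d :: "nat \<Rightarrow> real"
  assumes c: "\<And>i. i < m \<Longrightarrow> c i \<noteq> 0" and f[measurable]: "f \<in> borel_measurable (lborel_pow m)"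
  shows "(\<integral>\<^sup>+a. f a \<partial>lborel_pow m) =
    ennreal (\<Prod>i<m. \<bar>c i\<bar>) * (\<integral>\<^sup>+a. f (\<lambda>i\<in>{..<m}. d i + c i * a i) \<partial>lborel_pow m)"
proof -
  have "(\<integral>\<^sup>+a. f a \<partial>lborel_pow m) = (\<integral>\<^sup>+a. f a \<partial>density (distr (lborel_pow m) (lborel_pow m)
      (\<lambda>a. \<lambda>i\<in>{..<m}. d i + c i * a i)) (\<lambda>_. ennreal (\<Prod>i<m. \<bar>c i\<bar>)))"
    using lborel_pow_affine[of m c d] c by simp
  also have "\<dots> = ennreal (\<Prod>i<m. \<bar>c i\<bar>) * (\<integral>\<^sup>+a. f (\<lambda>i\<in>{..<m}. d i + c i * a i) \<partial>lborel_pow m)"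
    by (simp add: nn_integral_density nn_integral_cmult nn_integral_distr)
  finally show ?thesis .
qed

lemma emeasure_lborel_pow_affine:
  fixes c d :: "nat \<Rightarrow> real"
  assumes c: "\<And>i. i < m \<Longrightarrow> c i \<noteq> 0" and E: "E \<in> sets (lborel_pow m)"
  shows "emeasure (lborel_pow m) E = ennreal (\<Prod>i<m. \<bar>c i\<bar>) *
    emeasure (lborel_pow m) {a \<in> space (lborel_pow m). (\<lambda>i\<in>{..<m}. d i + c i * a i) \<in> E}"
proof -
  let ?T = "\<lambda>a. \<lambda>i\<in>{..<m}. d i + c i * a i"
  have E'[measurable]: "{a \<in> space (lborel_pow m). ?T a \<in> E} \<in> sets (lborel_pow m)"
    using measurable_sets[OF measurable_affine_map E, of d c] by (simp add: vimage_def Int_def conj_commute)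
  have "emeasure (lborel_pow m) E = (\<integral>\<^sup>+a. indicator E a \<partial>lborel_pow m)"
    using E by simp
  also have "\<dots> = ennreal (\<Prod>i<m. \<bar>c i\<bar>) * (\<integral>\<^sup>+a. indicator E (?T a) \<partial>lborel_pow m)"
    using E c by (intro nn_integral_lborel_pow_affine) auto
  also have "(\<integral>\<^sup>+a. indicator E (?T a) \<partial>lborel_pow m) =
      (\<integral>\<^sup>+a. indicator {a \<in> space (lborel_pow m). ?T a \<in> E} a \<partial>lborel_pow m)"
    by (intro nn_integral_cong) (simp add: indicator_def)
  finally show ?thesis using E' by simp
qed

section \<open>Balls and slabs: measurability, scaling, finite and positive volume\<close>

lemma measurable_eucl_norm[measurable]: "eucl_norm m \<in> borel_measurable (lborel_pow m)"
  unfolding eucl_norm_def by measurable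

lemma sets_ball: "{a \<in> {..<m} \<rightarrow>\<^sub>E UNIV. eucl_norm m a \<le> r} \<in> sets (lborel_pow m)"
proof -
  have "{a \<in> space (lborel_pow m). eucl_norm m a \<le> r} \<in> sets (lborel_pow m)" by measurable
  then show ?thesis by (simp add: space_PiM)
qed

lemma sets_unit_ball[measurable]: "unit_ball m \<in> sets (lborel_pow m)"
  unfolding unit_ball_def by (rule sets_ball)

lemma sets_slab:
  assumes "i < m"
  shows "{a \<in> unit_ball m. \<bar>a i\<bar> < t} \<in> sets (lborel_pow m)"
proof -
  have [measurable]: "(\<lambda>a. a i) \<in> borel_measurable (lborel_pow m)"
    using measurable_component_singleton[of i "{..<m}" "\<lambda>_. lborel :: real measure"] assms by simp
  have "{a \<in> space (lborel_pow m). \<bar>a i\<bar> < t} \<in> sets (lborel_pow m)" by measurable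
  then have "unit_ball m \<inter> {a \<in> space (lborel_pow m). \<bar>a i\<bar> < t} \<in> sets (lborel_pow m)"
    by (rule sets.Int[OF sets_unit_ball])
  moreover have "unit_ball m \<inter> {a \<in> space (lborel_pow m). \<bar>a i\<bar> < t} = {a \<in> unit_ball m. \<bar>a i\<bar> < t}"
    by (auto simp: unit_ball_def space_PiM)
  ultimately show ?thesis by simp
qed

lemma eucl_norm_scale: "eucl_norm m (\<lambda>i\<in>{..<m}. c * a i) = \<bar>c\<bar> * eucl_norm m a"
  by (simp add: eucl_norm_def power_mult_distrib real_sqrt_mult flip: sum_distrib_left)

lemma emeasure_ball:
  assumes "0 < r"
  shows "emeasure (lborel_pow m) {a \<in> {..<m} \<rightarrow>\<^sub>E UNIV. eucl_norm m a \<le> r} =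
    ennreal (r ^ m) * emeasure (lborel_pow m) (unit_ball m)"
proof -
  have "{a \<in> space (lborel_pow m). (\<lambda>i\<in>{..<m}. 0 + r * a i) \<in> {a \<in> {..<m} \<rightarrow>\<^sub>E UNIV. eucl_norm m a \<le> r}} = unit_ball m"
    using assms by (auto simp: space_PiM unit_ball_def eucl_norm_scale)
  then show ?thesis
    using emeasure_lborel_pow_affine[OF _ sets_ball[of m r], where c = "\<lambda>_. r" and d = "\<lambda>_. 0"] assms by simp
qed

lemma abs_le_eucl_norm: "i < m \<Longrightarrow> \<bar>a i\<bar> \<le> eucl_norm m a"
proof -
  assume "i < m"
  then have "(a i)\<^sup>2 \<le> (\<Sum>i<m. (a i)\<^sup>2)" by (intro member_le_sum) auto
  then show ?thesis unfolding eucl_norm_def using real_sqrt_le_mono by fastforce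
qed

lemma emeasure_unit_ball_finite: "emeasure (lborel_pow m) (unit_ball m) \<noteq> \<infinity>"
proof -
  interpret product_sigma_finite "\<lambda>_::nat. lborel :: real measure" by standard
  have "unit_ball m \<subseteq> (\<Pi>\<^sub>E i\<in>{..<m}. {-1..1})"
  proof
    fix a assume a: "a \<in> unit_ball m"
    have "\<bar>a i\<bar> \<le> 1" if "i < m" for i
    proof -
      have "eucl_norm m a \<le> 1" using a by (simp add: unit_ball_def)
      with abs_le_eucl_norm[OF that, of a] show ?thesis by linarith
    qed
    moreover have "a \<in> extensional {..<m}" using a by (simp add: unit_ball_def PiE_def)
    ultimately show "a \<in> (\<Pi>\<^sub>E i\<in>{..<m}. {-1..1})" by (simp add: PiE_iff abs_le_iff minus_le_iff)
  qed
  then have "emeasure (lborel_pow m) (unit_ball m) \<le> emeasure (lborel_pow m) (\<Pi>\<^sub>E i\<in>{..<m}. {-1..1})"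
    by (intro emeasure_mono sets_PiM_I_finite) auto
  also have "\<dots> = 2 ^ m"
    by (subst emeasure_PiM) auto
  also have "\<dots> < \<infinity>" by (simp add: power_less_top_ennreal)
  finally show ?thesis by simp
qed

lemma emeasure_unit_ball_pos:
  assumes "0 < m"
  shows "emeasure (lborel_pow m) (unit_ball m) \<noteq> 0"
proof -
  interpret product_sigma_finite "\<lambda>_::nat. lborel :: real measure" by standard
  let ?C = "\<Pi>\<^sub>E i\<in>{..<m}. {0..1 / real m}"
  have "?C \<subseteq> unit_ball m"
  proof
    fix a assume a: "a \<in> ?C"
    have "(\<Sum>i<m. (a i)\<^sup>2) \<le> (\<Sum>i<m. 1 / real m)"
    proof (rule sum_mono)
      fix i assume "i \<in> {..<m}"
      then have "0 \<le> a i" "a i \<le> 1 / real m" using a by (auto simp: PiE_iff)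
      moreover have "1 / real m \<le> 1" using assms by simp
      ultimately have "a i * a i \<le> (1 / real m) * 1" by (intro mult_mono) auto
      then show "(a i)\<^sup>2 \<le> 1 / real m" by (simp add: power2_eq_square)
    qed
    then show "a \<in> unit_ball m" using a assms by (auto simp: unit_ball_def eucl_norm_def PiE_iff)
  qed
  then have "emeasure (lborel_pow m) ?C \<le> emeasure (lborel_pow m) (unit_ball m)"
    by (intro emeasure_mono) auto
  moreover have "emeasure (lborel_pow m) ?C = ennreal ((1 / real m) ^ m)"
    by (subst emeasure_PiM) (auto simp: ennreal_power)
  moreover have "ennreal ((1 / real m) ^ m) > 0" using assms by simp
  ultimately show ?thesis by (metis not_le)
qed

text \<open>Six disjoint translates of a thin central slab of the ball fit into a slightly larger ball.\<close>

lemma emeasure_slab_le: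
  fixes m :: nat
  defines "t \<equiv> 1 / (8 * sqrt m)"
  assumes i: "i < m"
  shows "6 * emeasure (lborel_pow m) {a \<in> unit_ball m. \<bar>a i\<bar> < t} \<le> 3 * emeasure (lborel_pow m) (unit_ball m)"
proof -
  let ?L = "lborel_pow m"
  define T where "T = {a \<in> unit_ball m. \<bar>a i\<bar> < t}"
  have m: "real m > 0" using i by simp
  then have t: "t > 0" "t * t = 1 / (64 * real m)" unfolding t_def by (auto simp: field_simps)
  have T[measurable]: "T \<in> sets ?L"
    unfolding T_def using i by (rule sets_slab)
  \<comment> \<open>\<open>S j\<close> is the slab moved by \<open>2 j t\<close> along axis
    \<open>i\<close>; as the slab is open in that direction with width \<open>2 t\<close>, the
    translates are disjoint.\<close>
  define d where "d j = (\<lambda>k. if k = i then - 2 * real j * t else 0)" for j :: nat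
  define S where "S j = {a \<in> space ?L. (\<lambda>k\<in>{..<m}. d j k + 1 * a k) \<in> T}" for j
  have S[measurable]: "S j \<in> sets ?L" for j
    using measurable_sets[OF measurable_affine_map T, of "d j" "\<lambda>_. 1"]
    unfolding S_def by (simp add: vimage_def Int_def conj_commute)
  have eS: "emeasure ?L (S j) = emeasure ?L T" for j
    using emeasure_lborel_pow_affine[OF _ T, where c = "\<lambda>_. 1" and d = "d j"] unfolding S_def by simp
  have Si: "\<bar>a i - 2 * real j * t\<bar> < t" if "a \<in> S j" for a j
    using that i by (auto simp: S_def T_def d_def)
  have disj: "disjoint_family_on S {..<6}"
    unfolding disjoint_family_on_def
  proof (intro ballI impI)
    fix j k :: nat assume "j \<noteq> k"
    show "S j \<inter> S k = {}"
    proof (rule ccontr)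
      assume "S j \<inter> S k \<noteq> {}"
      then obtain a where "a \<in> S j" "a \<in> S k" by blast
      from Si[OF this(1)] Si[OF this(2)] have "\<bar>2 * real j * t - 2 * real k * t\<bar> < 2 * t" by linarith
      moreover have "2 * real j * t - 2 * real k * t = (real j - real k) * (2 * t)"
        by (simp add: algebra_simps)
      ultimately have "\<bar>real j - real k\<bar> * (2 * t) < 1 * (2 * t)"
        using t(1) by (simp add: abs_mult)
      then have "\<bar>real j - real k\<bar> < 1" using t(1) by simp
      then show False using \<open>j \<noteq> k\<close> by linarith
    qed
  qed
  \<comment> \<open>Large enough that \<open>r\<^sup>2 \<ge> 1 + 2 / m\<close> leaves room for the
    translates, small enough that the volume grows by at most \<open>exp 1 \<le> 3\<close>.\<close>
  define r where "r = 1 + 1 / real m"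
  have sub: "S j \<subseteq> {a \<in> {..<m} \<rightarrow>\<^sub>E UNIV. eucl_norm m a \<le> r}" if j: "j < 6" for j
  proof
    fix a assume a: "a \<in> S j"
    define b where "b = (\<lambda>k\<in>{..<m}. d j k + 1 * a k)"
    have b: "b \<in> unit_ball m" "\<bar>b i\<bar> < t" using a by (auto simp: S_def T_def b_def)
    have bk: "a k = (if k = i then b i + 2 * real j * t else b k)" if "k < m" for k
      using that i by (auto simp: b_def d_def)
    have "(\<Sum>k<m. (b k)\<^sup>2) \<le> 1" using b(1) by (simp add: unit_ball_def eucl_norm_def)
    have "(\<Sum>k<m. (a k)\<^sup>2) = (\<Sum>k<m. (b k)\<^sup>2 + (if k = i then 4 * real j * (t * b i) + 4 * (real j)\<^sup>2 * (t * t) else 0))"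
      using bk by (intro sum.cong refl) (auto simp: power2_eq_square algebra_simps)
    also have "\<dots> = (\<Sum>k<m. (b k)\<^sup>2) + (4 * real j * (t * b i) + 4 * (real j)\<^sup>2 * (t * t))"
      using i by (simp add: sum.distrib)
    also have "\<dots> \<le> 1 + (4 * real j * (t * t) + 4 * (real j)\<^sup>2 * (t * t))"
      using \<open>(\<Sum>k<m. (b k)\<^sup>2) \<le> 1\<close> b(2) t(1) by (intro add_mono mult_left_mono) auto
    also have "\<dots> = 1 + (4 * real j * (real j + 1)) * (t * t)"
      by (simp add: algebra_simps power2_eq_square)
    \<comment> \<open>The farthest translate has \<open>j = 5\<close>; with
      \<open>t * t = 1 / (64 m)\<close> the excess is \<open>120 / (64 m)\<close>, below
      \<open>2 / m\<close>.\<close>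
    also have "\<dots> \<le> 1 + (4 * 5 * (5 + 1)) * (t * t)"
      using j t by (intro add_left_mono mult_right_mono mult_mono) auto
    also have "\<dots> \<le> 1 + 2 / real m" using m by (simp add: t(2) field_simps)
    also have "\<dots> \<le> r\<^sup>2" by (simp add: r_def power2_eq_square algebra_simps)
    finally have "eucl_norm m a \<le> r"
      unfolding eucl_norm_def using m by (intro real_le_lsqrt) (auto simp: r_def intro: sum_nonneg)
    then show "a \<in> {a \<in> {..<m} \<rightarrow>\<^sub>E UNIV. eucl_norm m a \<le> r}"
      using a by (auto simp: S_def space_PiM)
  qed
  have rm: "r ^ m \<le> 3"
  proof -
    have "r ^ m \<le> exp (1 / real m) ^ m"
      unfolding r_def by (intro power_mono exp_ge_add_one_self) auto
    also have "\<dots> = exp 1" using m by (simp flip: exp_of_nat_mult)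
    also have "\<dots> \<le> 3" by (rule exp_le)
    finally show ?thesis .
  qed
  have "6 * emeasure ?L T = (\<Sum>j<6. emeasure ?L (S j))" by (simp add: eS)
  also have "\<dots> = emeasure ?L (\<Union>j<6. S j)"
    using disj by (intro sum_emeasure) auto
  also have "\<dots> \<le> emeasure ?L {a \<in> {..<m} \<rightarrow>\<^sub>E UNIV. eucl_norm m a \<le> r}"
    using sub by (intro emeasure_mono sets_ball) auto
  also have "\<dots> = ennreal (r ^ m) * emeasure ?L (unit_ball m)"
    using m by (intro emeasure_ball) (simp add: r_def add_pos_pos)
  also have "\<dots> \<le> ennreal 3 * emeasure ?L (unit_ball m)"
    using rm by (intro mult_right_mono ennreal_leI) auto
  finally show ?thesis by (simp add: T_def)
qed

text \<open>By the slab estimate at least half of the ball has a coordinate of modulus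
  \<open>1 / (8 * sqrt m)\<close> or more.\<close>

lemma nn_integral_abs_coordinate_ge:
  assumes i: "i < m"
  shows "ennreal (1 / (16 * sqrt m)) * emeasure (lborel_pow m) (unit_ball m) \<le>
    (\<integral>\<^sup>+a. ennreal \<bar>a i\<bar> * indicator (unit_ball m) a \<partial>lborel_pow m)"
proof -
  let ?L = "lborel_pow m"
  define t where "t = 1 / (8 * sqrt m)"
  define T where "T = {a \<in> unit_ball m. \<bar>a i\<bar> < t}"
  have t: "t \<ge> 0" by (simp add: t_def)
  have T[measurable]: "T \<in> sets ?L"
    unfolding T_def using i by (rule sets_slab)
  have TB: "T \<subseteq> unit_ball m" by (auto simp: T_def)
  have fin: "emeasure ?L (unit_ball m) \<noteq> \<infinity>" by (rule emeasure_unit_ball_finite)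
  have finT: "emeasure ?L T \<noteq> \<infinity>"
    using emeasure_mono[OF TB sets_unit_ball] fin by (metis neq_top_trans infinity_ennreal_def)
  define b where "b = measure ?L (unit_ball m)"
  define \<tau> where "\<tau> = measure ?L T"
  have eb: "emeasure ?L (unit_ball m) = ennreal b" and e\<tau>: "emeasure ?L T = ennreal \<tau>"
    using fin finT by (simp_all add: b_def \<tau>_def emeasure_eq_ennreal_measure)
  have nn: "0 \<le> b" "0 \<le> \<tau>" by (simp_all add: b_def \<tau>_def)
  have "6 * ennreal \<tau> \<le> 3 * ennreal b"
    using emeasure_slab_le[OF i] unfolding T_def[unfolded t_def, symmetric] eb e\<tau> .
  then have "ennreal (6 * \<tau>) \<le> ennreal (3 * b)"
    using nn by (simp add: ennreal_mult)
  then have half: "6 * \<tau> \<le> 3 * b" using nn by (simp add: ennreal_le_iff)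
  have "emeasure ?L (unit_ball m - T) = ennreal (b - \<tau>)"
    using TB finT nn by (subst emeasure_Diff) (auto simp: eb e\<tau> ennreal_minus)
  have "ennreal (1 / (16 * sqrt m)) * emeasure ?L (unit_ball m) = ennreal (t * (b / 2))"
    using nn by (simp add: eb t_def flip: ennreal_mult)
  also have "\<dots> \<le> ennreal (t * (b - \<tau>))"
    using half t by (intro ennreal_leI mult_left_mono) auto
  also have "\<dots> = ennreal t * emeasure ?L (unit_ball m - T)"
    using t half nn by (simp add: \<open>emeasure ?L (unit_ball m - T) = _\<close> ennreal_mult)
  also have "\<dots> = (\<integral>\<^sup>+a. ennreal t * indicator (unit_ball m - T) a \<partial>?L)"
    by (rule nn_integral_cmult_indicator[symmetric]) auto
  also have "\<dots> \<le> (\<integral>\<^sup>+a. ennreal \<bar>a i\<bar> * indicator (unit_ball m) a \<partial>?L)"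
    by (intro nn_integral_mono) (auto simp: indicator_def T_def intro!: ennreal_leI)
  finally show ?thesis .
qed

section \<open>From signed points to mean width\<close>

text \<open>For a direction \<open>a\<close>, the competitor in \<open>K\<close> is the point whose
  pattern matches the signs of \<open>a\<close>. Flipping the signs of \<open>a\<close> in all ways
  runs through all patterns, so the average over flips is a sum of the
  \<open>\<bar>a i\<bar>\<close> with the nonnegative weights \<open>p i\<close>.\<close>

lemma mean_width_ge_average:
  fixes y :: "nat set \<Rightarrow> nat \<Rightarrow> real"
  assumes m: "0 < m" and K: "\<And>P. P \<in> Pow {..<m} \<Longrightarrow> vec m (y P) \<in> K"
    and sign: "\<And>P j. P \<in> Pow {..<m} \<Longrightarrow> j < m \<Longrightarrow> 0 \<le> sgn_of P j * y P j"
    and avg: "2 ^ m * s \<le> (\<Sum>P\<in>Pow {..<m}. \<Sum>j<m. sgn_of P j * y P j)" and "0 \<le> s"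
  shows "ennreal (s / (16 * sqrt m)) \<le> mean_width m K"
proof -
  let ?L = "lborel_pow m"
  let ?B = "unit_ball m"
  \<comment> \<open>A finite maximum is real-valued and measurable. The width itself, possibly
    infinite, is only compared with \<open>F\<close> pointwise, so its measurability never has to be
    settled.\<close>
  define F where "F a = Max ((\<lambda>P. \<Sum>i<m. a i * y P i) ` Pow {..<m})" for a :: "nat \<Rightarrow> real"
  define flip where "flip Q a = (\<lambda>i\<in>{..<m}. 0 + sgn_of Q i * a i)" for Q and a :: "nat \<Rightarrow> real"
  define dir where "dir a = (\<lambda>i\<in>{..<m}. a i / eucl_norm m a)" for a :: "nat \<Rightarrow> real"
  define p where "p i = (\<Sum>P\<in>Pow {..<m}. sgn_of P i * y P i)" for i
  have p: "p i \<ge> 0" if "i < m" for i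
    unfolding p_def using sign that by (intro sum_nonneg) auto
  have F_ge: "(\<Sum>i<m. a i * y P i) \<le> F a" if "P \<in> Pow {..<m}" for a P
    unfolding F_def using that by (intro Max_ge) auto
  have sgn_sq: "sgn_of P i * sgn_of P i = 1" and sgn_abs: "\<bar>sgn_of P i\<bar> = 1" and sgn_nz: "sgn_of P i \<noteq> 0" for P i
    by (auto simp: sgn_of_def)
  define N where "N a = {i \<in> {..<m}. a i < 0}" for a :: "nat \<Rightarrow> real"
  have N: "N a \<in> Pow {..<m}" "{..<m} - N a \<in> Pow {..<m}" for a by (auto simp: N_def)
  have abs_N: "a i = sgn_of (N a) i * \<bar>a i\<bar>" "a i = - sgn_of ({..<m} - N a) i * \<bar>a i\<bar>" if "i < m" for a i
    using that by (auto simp: N_def sgn_of_def)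
  have scalar: "vec m a \<bullet> vec m (y P) = (\<Sum>i<m. a i * y P i)" for a P
    by (simp add: scalar_prod_def lessThan_atLeast0)

  have width: "ennreal (F a) \<le> e2ennreal ((SUP x\<in>K. ereal (vec m a \<bullet> x)) - (INF x\<in>K. ereal (vec m a \<bullet> x)))" for a
  proof -
    have "F a \<in> (\<lambda>P. \<Sum>i<m. a i * y P i) ` Pow {..<m}"
      unfolding F_def by (intro Max_in) auto
    then obtain P where P: "P \<in> Pow {..<m}" "F a = (\<Sum>i<m. a i * y P i)" by auto
    have "ereal (F a) \<le> (SUP x\<in>K. ereal (vec m a \<bullet> x))"
      unfolding P(2) scalar[symmetric] using K[OF P(1)] by (rule SUP_upper)
    \<comment> \<open>The point for the pattern opposite to the signs of \<open>a\<close> has a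
      nonpositive product with \<open>a\<close>.\<close>
    moreover have "(INF x\<in>K. ereal (vec m a \<bullet> x)) \<le> 0"
    proof -
      let ?P = "{..<m} - N a"
      have "(INF x\<in>K. ereal (vec m a \<bullet> x)) \<le> ereal (vec m a \<bullet> vec m (y ?P))"
        using K[OF N(2)] by (rule INF_lower)
      also have "vec m a \<bullet> vec m (y ?P) = (\<Sum>i<m. - (\<bar>a i\<bar> * (sgn_of ?P i * y ?P i)))"
        unfolding scalar
      proof (intro sum.cong refl)
        fix i assume "i \<in> {..<m}"
        then have "a i * y ?P i = (- sgn_of ?P i * \<bar>a i\<bar>) * y ?P i"
          using abs_N(2)[of i a] by simp
        then show "a i * y ?P i = - (\<bar>a i\<bar> * (sgn_of ?P i * y ?P i))" by (simp add: mult_ac)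
      qed
      also have "ereal \<dots> \<le> 0"
        using sign[OF N(2)] by (auto intro!: sum_nonpos simp: zero_ereal_def)
      finally show ?thesis .
    qed
    ultimately have "ereal (F a) - 0 \<le> (SUP x\<in>K. ereal (vec m a \<bullet> x)) - (INF x\<in>K. ereal (vec m a \<bullet> x))"
      by (rule ereal_minus_mono)
    then show ?thesis using e2ennreal_mono by fastforce
  qed

  have flips: "(\<Sum>i<m. \<bar>a i\<bar> * p i) \<le> (\<Sum>Q\<in>Pow {..<m}. F (flip Q a))" for a
  proof -
    \<comment> \<open>Symmetric difference with \<open>N a\<close>, an involution; it is the pattern
      of \<open>flip Q a\<close> and corresponds to the product of signs.\<close>
    let ?h = "\<lambda>Q. (Q - N a) \<union> (N a - Q)"
    have bij: "bij_betw ?h (Pow {..<m}) (Pow {..<m})"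
      by (rule bij_betwI[where g = ?h]) (use N in auto)
    have sg: "sgn_of Q i * sgn_of (N a) i = sgn_of (?h Q) i" for Q i
      by (auto simp: sgn_of_def)
    have "(\<Sum>i<m. \<bar>a i\<bar> * p i) = (\<Sum>P\<in>Pow {..<m}. \<Sum>i<m. \<bar>a i\<bar> * (sgn_of P i * y P i))"
      unfolding p_def sum_distrib_left by (rule sum.swap)
    also have "\<dots> = (\<Sum>Q\<in>Pow {..<m}. \<Sum>i<m. \<bar>a i\<bar> * (sgn_of (?h Q) i * y (?h Q) i))"
      by (rule sum.reindex_bij_betw[OF bij, symmetric])
    also have "\<dots> = (\<Sum>Q\<in>Pow {..<m}. \<Sum>i<m. flip Q a i * y (?h Q) i)"
    proof (intro sum.cong refl)
      fix Q i assume "i \<in> {..<m}"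
      then have "flip Q a i = sgn_of Q i * (sgn_of (N a) i * \<bar>a i\<bar>)"
        using abs_N(1)[of i a] by (simp add: flip_def)
      then show "\<bar>a i\<bar> * (sgn_of (?h Q) i * y (?h Q) i) = flip Q a i * y (?h Q) i"
        by (simp add: sg[symmetric] mult_ac)
    qed
    also have "\<dots> \<le> (\<Sum>Q\<in>Pow {..<m}. F (flip Q a))"
      using N by (intro sum_mono F_ge) auto
    finally show ?thesis .
  qed

  have [measurable]: "dir \<in> ?L \<rightarrow>\<^sub>M Pi\<^sub>M {..<m} (\<lambda>_. borel)"
    unfolding dir_def by (rule measurable_restrict) measurable
  have F_meas[measurable]: "F \<in> borel_measurable (Pi\<^sub>M {..<m} (\<lambda>_. borel))"
    unfolding F_def by (rule borel_measurable_Max) (auto intro!: borel_measurable_sum)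
  have flip_meas[measurable]: "flip Q \<in> ?L \<rightarrow>\<^sub>M ?L" for Q
    unfolding flip_def by (rule measurable_affine_map)

  \<comment> \<open>Up to division by the volume of the ball, the expectation of \<open>F\<close>
    under \<open>uniform_sphere m\<close>.\<close>
  define I where "I = (\<integral>\<^sup>+a. ennreal (F (dir a)) * indicator ?B a \<partial>?L)"
  have norm_flip: "eucl_norm m (flip Q a) = eucl_norm m a" for Q a
    by (simp add: eucl_norm_def flip_def power_mult_distrib power2_eq_square[of "sgn_of _ _"] sgn_sq)
  have dir_flip: "dir (flip Q a) = flip Q (dir a)" for Q a
    unfolding dir_def norm_flip by (auto simp: flip_def restrict_def fun_eq_iff)
  have ball_flip: "flip Q a \<in> ?B \<longleftrightarrow> a \<in> ?B" if "a \<in> space ?L" for Q a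
    using that norm_flip by (auto simp: unit_ball_def space_PiM flip_def)
  have I_flip: "I = (\<integral>\<^sup>+a. ennreal (F (flip Q (dir a))) * indicator ?B a \<partial>?L)" for Q
  proof -
    have "I = ennreal (\<Prod>i<m. \<bar>sgn_of Q i\<bar>) * (\<integral>\<^sup>+a. ennreal (F (dir (flip Q a))) * indicator ?B (flip Q a) \<partial>?L)"
      unfolding I_def flip_def using sgn_nz
      by (intro nn_integral_lborel_pow_affine) auto
    also have "\<dots> = (\<integral>\<^sup>+a. ennreal (F (flip Q (dir a))) * indicator ?B a \<partial>?L)"
      by (simp add: sgn_abs dir_flip) (auto intro!: nn_integral_cong simp: ball_flip indicator_def)
    finally show ?thesis .
  qed
  have F_nonneg: "0 \<le> F a" for a
  proof -
    have "0 \<le> (\<Sum>i<m. \<bar>a i\<bar> * (sgn_of (N a) i * y (N a) i))"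
      using sign[OF N(1)] by (intro sum_nonneg) auto
    also have "\<dots> = (\<Sum>i<m. a i * y (N a) i)"
    proof (intro sum.cong refl)
      fix i assume "i \<in> {..<m}"
      then have "a i * y (N a) i = (sgn_of (N a) i * \<bar>a i\<bar>) * y (N a) i"
        using abs_N(1)[of i a] by simp
      then show "\<bar>a i\<bar> * (sgn_of (N a) i * y (N a) i) = a i * y (N a) i" by (simp only: mult_ac)
    qed
    also have "\<dots> \<le> F a" using N(1) by (rule F_ge)
    finally show ?thesis .
  qed
  \<comment> \<open>Projecting from the ball to the sphere only enlarges coordinates, so the
    estimate over the ball suffices and no polar coordinates are needed.\<close>
  have dir_ge: "\<bar>a i\<bar> \<le> \<bar>dir a i\<bar>" if "a \<in> ?B" "i < m" for a i
  proof (cases "eucl_norm m a = 0")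
    case True
    then show ?thesis using abs_le_eucl_norm[OF that(2), of a] by simp
  next
    case False
    moreover have "0 \<le> eucl_norm m a"
      by (simp add: eucl_norm_def sum_nonneg)
    ultimately have pos: "0 < eucl_norm m a" by simp
    have "\<bar>a i\<bar> * eucl_norm m a \<le> \<bar>a i\<bar>"
      using that(1) by (intro mult_left_le) (auto simp: unit_ball_def)
    then have "\<bar>a i\<bar> \<le> \<bar>a i\<bar> / eucl_norm m a"
      using pos by (simp add: pos_le_divide_eq)
    moreover have "\<bar>dir a i\<bar> = \<bar>a i\<bar> / eucl_norm m a"
      using that(2) pos by (simp add: dir_def)
    ultimately show ?thesis by simp
  qed

  have "ennreal (2 ^ m * s) * (ennreal (1 / (16 * sqrt m)) * emeasure ?L ?B) \<le>
      (\<Sum>i<m. ennreal (p i)) * (ennreal (1 / (16 * sqrt m)) * emeasure ?L ?B)"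
  proof (intro mult_right_mono)
    have "(\<Sum>P\<in>Pow {..<m}. \<Sum>j<m. sgn_of P j * y P j) = (\<Sum>i<m. p i)"
      unfolding p_def by (rule sum.swap)
    then show "ennreal (2 ^ m * s) \<le> (\<Sum>i<m. ennreal (p i))"
      using avg p by (subst sum_ennreal) (auto intro!: ennreal_leI)
  qed auto
  also have "\<dots> \<le> (\<Sum>i<m. ennreal (p i) * (\<integral>\<^sup>+a. ennreal \<bar>a i\<bar> * indicator ?B a \<partial>?L))"
    unfolding sum_distrib_right by (intro sum_mono mult_left_mono nn_integral_abs_coordinate_ge) auto
  also have "\<dots> = (\<integral>\<^sup>+a. (\<Sum>i<m. ennreal (p i) * (ennreal \<bar>a i\<bar> * indicator ?B a)) \<partial>?L)"
    by (subst nn_integral_sum) (auto intro!: sum.cong nn_integral_cmult[symmetric])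
  also have "\<dots> \<le> (\<integral>\<^sup>+a. (\<Sum>Q\<in>Pow {..<m}. ennreal (F (flip Q (dir a))) * indicator ?B a) \<partial>?L)"
  proof (rule nn_integral_mono)
    fix a
    show "(\<Sum>i<m. ennreal (p i) * (ennreal \<bar>a i\<bar> * indicator ?B a)) \<le>
      (\<Sum>Q\<in>Pow {..<m}. ennreal (F (flip Q (dir a))) * indicator ?B a)"
    proof (cases "a \<in> ?B")
      case True
      have "(\<Sum>i<m. ennreal (p i) * ennreal \<bar>a i\<bar>) = ennreal (\<Sum>i<m. p i * \<bar>a i\<bar>)"
        using p by (subst sum_ennreal[symmetric]) (auto simp: ennreal_mult intro!: sum.cong)
      also have "\<dots> \<le> ennreal (\<Sum>i<m. \<bar>dir a i\<bar> * p i)"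
        using p dir_ge[OF True] by (intro ennreal_leI sum_mono) (simp add: mult.commute mult_left_mono)
      also have "\<dots> \<le> ennreal (\<Sum>Q\<in>Pow {..<m}. F (flip Q (dir a)))"
        by (intro ennreal_leI flips)
      also have "\<dots> = (\<Sum>Q\<in>Pow {..<m}. ennreal (F (flip Q (dir a))))"
        using F_nonneg by (subst sum_ennreal) auto
      finally show ?thesis using True by simp
    qed simp
  qed
  also have "\<dots> = (\<Sum>Q\<in>Pow {..<m}. (\<integral>\<^sup>+a. ennreal (F (flip Q (dir a))) * indicator ?B a \<partial>?L))"
  proof (rule nn_integral_sum)
    fix Q
    have "(\<lambda>a. F (flip Q (dir a))) = (\<lambda>a. F (dir (flip Q a)))" by (simp add: dir_flip)
    then have "(\<lambda>a. F (flip Q (dir a))) \<in> borel_measurable ?L" by simp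
    then show "(\<lambda>a. ennreal (F (flip Q (dir a))) * indicator ?B a) \<in> borel_measurable ?L" by simp
  qed
  also have "\<dots> = 2 ^ m * I"
    using I_flip by (simp add: card_Pow)
  finally have main: "ennreal (2 ^ m * s) * (ennreal (1 / (16 * sqrt m)) * emeasure ?L ?B) \<le> 2 ^ m * I" .
  have "ennreal (s / (16 * sqrt m)) * emeasure ?L ?B \<le> I"
  proof -
    have "ennreal (2 ^ m * s) * (ennreal (1 / (16 * sqrt m)) * emeasure ?L ?B)
        = ennreal (2 ^ m) * (ennreal (s / (16 * sqrt m)) * emeasure ?L ?B)"
      using \<open>0 \<le> s\<close> by (simp add: mult.assoc[symmetric] flip: ennreal_mult)
    then have "ennreal (2 ^ m) * (ennreal (s / (16 * sqrt m)) * emeasure ?L ?B) \<le> ennreal (2 ^ m) * I"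
      using main by (simp flip: ennreal_power)
    then show ?thesis by (simp add: ennreal_mult_le_mult_iff)
  qed
  then have "ennreal (s / (16 * sqrt m)) * emeasure ?L ?B / emeasure ?L ?B \<le> I / emeasure ?L ?B"
    by (rule divide_right_mono_ennreal)
  then have "ennreal (s / (16 * sqrt m)) \<le> I / emeasure ?L ?B"
    using emeasure_unit_ball_pos[OF m] emeasure_unit_ball_finite[of m] by (simp add: mult_divide_eq_ennreal)
  also have "I / emeasure ?L ?B = (\<integral>\<^sup>+a. ennreal (F (dir a)) \<partial>uniform_measure ?L ?B)"
    unfolding I_def by (subst nn_integral_uniform_measure) auto
  also have "\<dots> = (\<integral>\<^sup>+a. ennreal (F a) \<partial>uniform_sphere m)"
    unfolding uniform_sphere_def unit_ball_def[symmetric] dir_def[symmetric]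
    by (subst nn_integral_distr) (auto simp: uniform_measure_def)
  also have "\<dots> \<le> mean_width m K"
    unfolding mean_width_def by (intro nn_integral_mono width)
  finally show ?thesis .
qed

theorem theorem2:
  shows "\<exists>c::real. c > 0 \<and>
    (\<forall>(n::nat) (m::nat) (\<epsilon>::real) (A :: nat \<Rightarrow> real mat).
       (\<forall>i<m. A i \<in> carrier_mat n n \<and> transpose_mat (A i) = A i) \<longrightarrow>
       msum n m (\<lambda>i. mat_abs (A i)) \<preceq>\<^sub>L 1\<^sub>m n \<longrightarrow>
       0 < \<epsilon> \<longrightarrow> \<epsilon> < 1 \<longrightarrow>
       real m = real n / \<epsilon>\<^sup>2 \<longrightarrow> m \<ge> 100 \<longrightarrow>
       mean_width m {x \<in> carrier_vec m. op_norm (msum n m (\<lambda>i. x $ i \<cdot>\<^sub>m A i)) \<le> \<epsilon>}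
         \<ge> ennreal (c * sqrt (real m)))"
proof (intro exI[of _ "1 / 24576"] conjI allI impI)
  fix n m :: nat and \<epsilon> :: real and A :: "nat \<Rightarrow> real mat"
  assume A: "\<forall>i<m. A i \<in> carrier_mat n n \<and> transpose_mat (A i) = A i"
    and dom: "msum n m (\<lambda>i. mat_abs (A i)) \<preceq>\<^sub>L 1\<^sub>m n"
    and \<epsilon>: "0 < \<epsilon>" "\<epsilon> < 1" and m_eq: "real m = real n / \<epsilon>\<^sup>2" and m: "m \<ge> 100"
  have "\<exists>y. (\<forall>P\<in>Pow {..<m}. (\<forall>j<m. 0 \<le> sgn_of P j * y P j) \<and>
      op_norm (msum n m (\<lambda>i. y P i \<cdot>\<^sub>m A i)) \<le> \<epsilon>) \<and>
    2 ^ m * (real m / 1536) \<le> (\<Sum>P\<in>Pow {..<m}. \<Sum>j<m. sgn_of P j * y P j)"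
    by (rule exists_signed_points[OF _ _ dom \<epsilon> m_eq]) (use A m in auto)
  then obtain y where y: "\<And>P. P \<in> Pow {..<m} \<Longrightarrow> (\<forall>j<m. 0 \<le> sgn_of P j * y P j) \<and>
      op_norm (msum n m (\<lambda>i. y P i \<cdot>\<^sub>m A i)) \<le> \<epsilon>"
    "2 ^ m * (real m / 1536) \<le> (\<Sum>P\<in>Pow {..<m}. \<Sum>j<m. sgn_of P j * y P j)"
    by blast
  have "msum n m (\<lambda>i. vec m (y P) $ i \<cdot>\<^sub>m A i) = msum n m (\<lambda>i. y P i \<cdot>\<^sub>m A i)" for P
    unfolding msum_def by (intro arg_cong[where f = "mat n n"] ext sum.cong) auto
  then have "ennreal (real m / 1536 / (16 * sqrt m)) \<le>
      mean_width m {x \<in> carrier_vec m. op_norm (msum n m (\<lambda>i. x $ i \<cdot>\<^sub>m A i)) \<le> \<epsilon>}"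
    using y m by (intro mean_width_ge_average[of m y]) auto
  \<comment> \<open>The constant is \<open>1536 * 16\<close>: the average gain of the walk times the
    loss in the coordinate estimate.\<close>
  moreover have "real m / 1536 / (16 * sqrt m) = 1 / 24576 * sqrt m"
    using m real_div_sqrt[of "real m"] by simp
  ultimately show "ennreal (1 / 24576 * sqrt (real m)) \<le>
      mean_width m {x \<in> carrier_vec m. op_norm (msum n m (\<lambda>i. x $ i \<cdot>\<^sub>m A i)) \<le> \<epsilon>}"
    by (simp only:)
qed simp

end
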